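(* Let $\nu$ be a probability measure on $\mathbb{R}^d$ that is absolutely continuous with respect to the Lebesgue measure and has a finite second moment. Suppose that $\nu$ is $\kappa$-semi-log-concave for some $\kappa\in\mathbb{R}$ and that $D:=(1/\sqrt2)\,\mathrm{diam}(\mathrm{supp}(\nu))\in(0,\infty)$. Then for any $\underline{t}\in(0,1)$ there exists a unique solution $(X_t)_{t\in[0,1-\underline{t}]}$ to the initial value problem $$\frac{dX_t}{dt}(x)=v(t,X_t(x)),\quad X_0(x)=x\sim\mu,\quad t\in[0,1-\underline{t}].$$ Moreover, the push-forward measure satisfies ${X_t}_{\#}\mu=\mathrm{Law}(a_t\mathsf{Z}+b_t\mathsf{X}_1)$ with $\mathsf{Z}\sim\gamma_d$ and $\mathsf{X}_1\sim\nu$ independent.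
   Context: Fix functions $a_t,b_t$ of $t\in[0,1]$ (a dot denotes the time derivative) satisfying: $\dot a_t\le 0$, $\dot b_t\ge 0$, $a_0>0$, $b_0\ge 0$, $a_1=0$, $b_1=1$; $a_t>0$ and $b_t>0$ for all $t\in(0,1)$; $a_t,b_t\in C^2([0,1))$, $a_t^2\in C^1([0,1])$, $b_t\in C^1([0,1])$. Let $\gamma_d:=N(0,\mathbf{I}_d)$, let $\mathsf{Z}\sim\gamma_d$ and $\mathsf{X}_1\sim\nu$ be independent, $\mathsf{X}_t=a_t\mathsf{Z}+b_t\mathsf{X}_1$, and $\mu=\mathrm{Law}(\mathsf{X}_0)=\mathrm{Law}(a_0\mathsf{Z}+b_0\mathsf{X}_1)$. The velocity field is $v(t,x)=\mathbb{E}[\dot a_t\mathsf{Z}+\dot b_t\mathsf{X}_1\mid\mathsf{X}_t=x]$ for $t\in(0,1)$ and $v(0,x)=\lim_{t\downarrow0}v(t,x)$. A probability measure $\exp(-U)\,dx$ is $\kappa$-semi-log-concave ($\kappa\in\mathbb{R}$) if its support $\Omega\subseteq\mathbb{R}^d$ is convex and $U\in C^2(\Omega)$ satisfies $\nabla^2U(x)\succeq\kappa\mathbf{I}_d$ on $\Omega$. *)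

theory Defs
  imports "HOL-Probability.Probability"
begin

definition C1_on :: "real set \<Rightarrow> (real \<Rightarrow> real) \<Rightarrow> bool" where
  "C1_on S f \<longleftrightarrow>
     (\<exists>f'. (\<forall>t\<in>S. (f has_real_derivative f' t) (at t within S)) \<and> continuous_on S f')"

definition C2_on :: "real set \<Rightarrow> (real \<Rightarrow> real) \<Rightarrow> bool" where
  "C2_on S f \<longleftrightarrow>
     (\<exists>f'. (\<forall>t\<in>S. (f has_real_derivative f' t) (at t within S)) \<and> C1_on S f')"

text \<open>The time derivative on \<open>[0,1]\<close>, one-sided at the endpoints.\<close>

definition time_deriv :: "(real \<Rightarrow> real) \<Rightarrow> real \<Rightarrow> real" where
  "time_deriv f t = vector_derivative f (at t within {0..1})"

text \<open>The function \<open>a\<close> need not be differentiable at \<open>1\<close> (for instance \<open>a t = sqrt (1 - t^2)\<close>),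
  so its monotonicity condition is imposed on \<open>[0,1)\<close> only.\<close>

definition interpolation_coeffs :: "(real \<Rightarrow> real) \<Rightarrow> (real \<Rightarrow> real) \<Rightarrow> bool" where
  "interpolation_coeffs a b \<longleftrightarrow>
     (\<forall>t\<in>{0..<1}. time_deriv a t \<le> 0) \<and> (\<forall>t\<in>{0..1}. time_deriv b t \<ge> 0) \<and>
     a 0 > 0 \<and> b 0 \<ge> 0 \<and> a 1 = 0 \<and> b 1 = 1 \<and>
     (\<forall>t\<in>{0<..<1}. a t > 0 \<and> b t > 0) \<and>
     C2_on {0..<1} a \<and> C2_on {0..<1} b \<and>
     C1_on {0..1} (\<lambda>t. (a t)\<^sup>2) \<and> C1_on {0..1} b"

definition std_gaussian :: "'a::euclidean_space measure" where
  "std_gaussian =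
     density lborel (\<lambda>x. ennreal (exp (- (norm x)\<^sup>2 / 2) / sqrt (2 * pi) ^ DIM('a)))"

definition msupport :: "'a::topological_space measure \<Rightarrow> 'a set" where
  "msupport \<nu> = {x. \<forall>W. open W \<and> x \<in> W \<longrightarrow> emeasure \<nu> W > 0}"

text \<open>Since the support \<open>\<Omega>\<close> is closed, the gradient \<open>G\<close> and the Hessian \<open>H\<close> of the potential \<open>U\<close>
  are taken on the interior of \<open>\<Omega>\<close>. Its boundary is Lebesgue null by convexity, so restricting the
  density \<open>exp (- U)\<close> to the interior does not change the measure; no regularity of \<open>U\<close> up to the
  boundary is required.\<close>

definition semi_log_concave :: "real \<Rightarrow> 'a::euclidean_space measure \<Rightarrow> bool" where
  "semi_log_concave \<kappa> \<nu> \<longleftrightarrow>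
     convex (msupport \<nu>) \<and>
     (\<exists>(U :: 'a \<Rightarrow> real) (G :: 'a \<Rightarrow> 'a) (H :: 'a \<Rightarrow> 'a \<Rightarrow>\<^sub>L 'a).
        \<nu> = density lborel (\<lambda>x. ennreal (exp (- U x)) * indicator (interior (msupport \<nu>)) x) \<and>
        (\<forall>x\<in>interior (msupport \<nu>).
           GDERIV U x :> G x \<and> (G has_derivative blinfun_apply (H x)) (at x)) \<and>
        continuous_on (interior (msupport \<nu>)) H \<and>
        (\<forall>x\<in>interior (msupport \<nu>). \<forall>h. blinfun_apply (H x) h \<bullet> h \<ge> \<kappa> * (norm h)\<^sup>2))"

definition interpolant ::
  "('b \<Rightarrow> 'a::euclidean_space) \<Rightarrow> ('b \<Rightarrow> 'a) \<Rightarrow> (real \<Rightarrow> real) \<Rightarrow> (real \<Rightarrow> real) \<Rightarrow> real \<Rightarrow> 'b \<Rightarrow> 'a"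
where
  "interpolant Z X1 a b t = (\<lambda>\<omega>. a t *\<^sub>R Z \<omega> + b t *\<^sub>R X1 \<omega>)"

text \<open>The function \<open>x \<mapsto> E[Y | X = x]\<close>. Conditioning on \<open>X\<close> determines it only up to null
  sets of the law of \<open>X\<close>; the continuous version is meant. It is unique whenever that law charges
  every nonempty open set, as the law of the interpolant does for times in \<open>(0,1)\<close>.\<close>

definition cond_exp_given ::
  "'b measure \<Rightarrow> ('b \<Rightarrow> 'a::euclidean_space) \<Rightarrow> ('b \<Rightarrow> 'c::euclidean_space) \<Rightarrow> 'c \<Rightarrow> 'a"
where
  "cond_exp_given M Y X =
     (THE g. continuous_on UNIV g \<and>
        (\<forall>i\<in>Basis. AE \<omega> in M. g (X \<omega>) \<bullet> i =
           real_cond_exp M (vimage_algebra (space M) X borel) (\<lambda>\<omega>. Y \<omega> \<bullet> i) \<omega>))"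

definition interior_velocity ::
  "'b measure \<Rightarrow> ('b \<Rightarrow> 'a::euclidean_space) \<Rightarrow> ('b \<Rightarrow> 'a) \<Rightarrow> (real \<Rightarrow> real) \<Rightarrow> (real \<Rightarrow> real) \<Rightarrow>
     real \<Rightarrow> 'a \<Rightarrow> 'a"
where
  "interior_velocity M Z X1 a b t =
     cond_exp_given M (\<lambda>\<omega>. time_deriv a t *\<^sub>R Z \<omega> + time_deriv b t *\<^sub>R X1 \<omega>)
       (interpolant Z X1 a b t)"

definition velocity ::
  "'b measure \<Rightarrow> ('b \<Rightarrow> 'a::euclidean_space) \<Rightarrow> ('b \<Rightarrow> 'a) \<Rightarrow> (real \<Rightarrow> real) \<Rightarrow> (real \<Rightarrow> real) \<Rightarrow>
     real \<Rightarrow> 'a \<Rightarrow> 'a"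
where
  "velocity M Z X1 a b t x =
     (if t = 0 then Lim (at_right 0) (\<lambda>s. interior_velocity M Z X1 a b s x)
      else interior_velocity M Z X1 a b t x)"

definition ivp_solution ::
  "(real \<Rightarrow> 'a::real_normed_vector \<Rightarrow> 'a) \<Rightarrow> real \<Rightarrow> 'a \<Rightarrow> (real \<Rightarrow> 'a) \<Rightarrow> bool" where
  "ivp_solution v T x y \<longleftrightarrow>
     y 0 = x \<and> (\<forall>t\<in>{0..T}. (y has_vector_derivative v t (y t)) (at t within {0..T}))"

end

theory Submission
  imports Defs
begin

text \<open>Since \<open>\<nu>\<close> has bounded support, the velocity is explicit for \<open>t < 1\<close>:
  \<open>V t x = (a' / a) *\<^sub>R x + (b' - a' * b / a) *\<^sub>R m t x\<close>, where \<open>m t x\<close> is the mean of \<open>\<nu>\<close> tilted by an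
  exponential weight. Tilted means of a bounded measure have bounded first and second derivatives in the
  parameter, so on \<open>[0, 1 - tl]\<close> the field is Lipschitz in \<open>x\<close> and continuous in \<open>t\<close>, also at
  \<open>t = 0\<close>, and the flow exists uniquely by Picard's theorem.

  The law is identified without the continuity equation. For a test function \<open>g\<close> of class
  \<open>C\<^sup>1\<^sup>,\<^sup>1\<close>, the expectations of \<open>g\<close> at the interpolant at time \<open>t + h\<close> and at its Euler step
  \<open>x + h *\<^sub>R V t x\<close> from time \<open>t\<close> differ by \<open>o(h)\<close>, because \<open>V t\<close> is the conditional mean of the time
  derivative. Euler maps preserve \<open>C\<^sup>1\<^sup>,\<^sup>1\<close> bounds up to a factor \<open>1 + O(h)\<close>, so the errors add up to
  \<open>o(1)\<close>, while the Euler scheme converges to the flow; and bounded \<open>C\<^sup>1\<^sup>,\<^sup>1\<close> functions determine a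
  probability measure.\<close>

section \<open>Functions with Lipschitz derivative\<close>

text \<open>The test class has to meet three demands at once. The expansion at the interpolant needs
  a second-order remainder: once conditioning removes the first-order term, only
  \<open>h * h\<close> and the linearization errors of \<open>a\<close> and \<open>b\<close> are
  left, whereas a mere Lipschitz bound would leave an error of order \<open>h\<close> per step.
  Composition with an Euler map must stay in the class with explicit constants, because the
  induction over the steps moves the last Euler map into the test function. And the class must
  approximate indicators of boxes. \<open>C11\<close> states the remainder bound itself instead of a
  Lipschitz condition on the derivative, so that composition needs only the triangle inequality. For
  the field, the obstacle is uniformity in \<open>x\<close>, since the tilt parameter
  \<open>(b / a^2) x\<close> is unbounded. A tilt of a tilted measure is again a tilt and keeps the
  bound on the support, so every estimate reduces to a small perturbation of some measure bounded by
  \<open>R\<close>, with constants depending only on \<open>R\<close>.\<close>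

definition C11 :: "real \<Rightarrow> real \<Rightarrow> ('a::real_normed_vector \<Rightarrow> 'b::real_normed_vector) \<Rightarrow> bool" where
  "C11 L C f \<longleftrightarrow> (\<exists>f'. \<forall>x. linear (f' x) \<and> (\<forall>h. norm (f' x h) \<le> L * norm h) \<and>
     (\<forall>y. norm (f y - f x) \<le> L * norm (y - x)) \<and>
     (\<forall>y. norm (f y - f x - f' x (y - x)) \<le> C * (norm (y - x))\<^sup>2))"

lemma C11I:
  assumes "\<And>x. linear (f' x)" "\<And>x h. norm (f' x h) \<le> L * norm h"
    and "\<And>x y. norm (f y - f x) \<le> L * norm (y - x)"
    and "\<And>x y. norm (f y - f x - f' x (y - x)) \<le> C * (norm (y - x))\<^sup>2"
  shows "C11 L C f"
  unfolding C11_def using assms by blast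

lemma C11E:
  assumes "C11 L C f"
  obtains f' where "\<And>x. linear (f' x)" "\<And>x h. norm (f' x h) \<le> L * norm h"
    "\<And>x y. norm (f y - f x) \<le> L * norm (y - x)"
    "\<And>x y. norm (f y - f x - f' x (y - x)) \<le> C * (norm (y - x))\<^sup>2"
  using assms unfolding C11_def by blast

lemma C11_lipschitz: "C11 L C f \<Longrightarrow> norm (f y - f x) \<le> L * norm (y - x)"
  unfolding C11_def by blast

lemma C11_continuous_on:
  assumes "C11 L C f" shows "continuous_on S f"
proof (rule lipschitz_on_continuous_on)
  show "(max 0 L)-lipschitz_on S f"
  proof (rule lipschitz_onI)
    fix x y
    have "norm (f x - f y) \<le> L * norm (x - y)" using assms by (rule C11_lipschitz)
    also have "\<dots> \<le> max 0 L * norm (x - y)" by (intro mult_right_mono) auto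
    finally show "dist (f x) (f y) \<le> max 0 L * dist x y" by (simp add: dist_norm)
  qed simp
qed

lemma C11_mono:
  fixes f :: "'a::real_normed_vector \<Rightarrow> 'b::real_normed_vector"
  assumes "C11 L C f" "L \<le> L'" "C \<le> C'" shows "C11 L' C' f"
proof -
  from assms(1) obtain f' where f': "\<And>x. linear (f' x)" "\<And>x h. norm (f' x h) \<le> L * norm h"
    "\<And>x y. norm (f y - f x) \<le> L * norm (y - x)"
    "\<And>x y. norm (f y - f x - f' x (y - x)) \<le> C * (norm (y - x))\<^sup>2" by (rule C11E) blast
  show ?thesis
  proof (rule C11I[of f'])
    fix x y h :: 'a
    have "L * norm h \<le> L' * norm h" "L * norm (y - x) \<le> L' * norm (y - x)"
      "C * (norm (y - x))\<^sup>2 \<le> C' * (norm (y - x))\<^sup>2"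
      using assms by (auto intro!: mult_right_mono)
    then show "norm (f' x h) \<le> L' * norm h" "norm (f y - f x) \<le> L' * norm (y - x)"
      "norm (f y - f x - f' x (y - x)) \<le> C' * (norm (y - x))\<^sup>2"
      using f'(2)[of x h] f'(3)[of y x] f'(4)[of y x] by linarith+
  qed (rule f')
qed

text \<open>The remainder splits along the chain rule: the remainder of \<open>g\<close> over the
  increment of \<open>f\<close> costs \<open>C * L'\<^sup>2\<close>, and the derivative of
  \<open>g\<close> applied to the remainder of \<open>f\<close> costs \<open>L * C'\<close>. For an
  Euler map, \<open>L'\<close> is 1 + O(h) and \<open>C'\<close> is O(h), which is where the growth
  factor per step comes from.\<close>

lemma C11_compose:
  assumes g: "C11 L C g" and f: "C11 L' C' f" and "0 \<le> L" "0 \<le> C"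
  shows "C11 (L * L') (C * L'\<^sup>2 + L * C') (\<lambda>x. g (f x))"
proof -
  from f obtain f' where f': "\<And>x. linear (f' x)" "\<And>x h. norm (f' x h) \<le> L' * norm h"
    "\<And>x y. norm (f y - f x) \<le> L' * norm (y - x)"
    "\<And>x y. norm (f y - f x - f' x (y - x)) \<le> C' * (norm (y - x))\<^sup>2" by (rule C11E) blast
  from g obtain g' where g': "\<And>x. linear (g' x)" "\<And>x h. norm (g' x h) \<le> L * norm h"
    "\<And>x y. norm (g y - g x) \<le> L * norm (y - x)"
    "\<And>x y. norm (g y - g x - g' x (y - x)) \<le> C * (norm (y - x))\<^sup>2" by (rule C11E) blast
  show ?thesis
  proof (rule C11I[of "\<lambda>x. g' (f x) \<circ> f' x"])
    fix x y h
    show "linear (g' (f x) \<circ> f' x)" using f'(1) g'(1) by (rule linear_compose)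
    have "norm (g' (f x) (f' x h)) \<le> L * (L' * norm h)"
      using g'(2)[of "f x" "f' x h"] mult_left_mono[OF f'(2)[of x h] \<open>0 \<le> L\<close>] by linarith
    then show "norm ((g' (f x) \<circ> f' x) h) \<le> L * L' * norm h" by (simp add: mult.assoc)
    show "norm (g (f y) - g (f x)) \<le> L * L' * norm (y - x)"
      using g'(3)[of "f y" "f x"] mult_left_mono[OF f'(3)[of y x] \<open>0 \<le> L\<close>] by (simp add: mult.assoc)
    have "g (f y) - g (f x) - (g' (f x) \<circ> f' x) (y - x)
        = (g (f y) - g (f x) - g' (f x) (f y - f x)) + g' (f x) (f y - f x - f' x (y - x))"
      using linear_diff[OF g'(1)] by simp
    also have "norm \<dots> \<le> C * (norm (f y - f x))\<^sup>2 + L * norm (f y - f x - f' x (y - x))"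
      by (rule norm_triangle_le, rule add_mono[OF g'(4) g'(2)])
    also have "\<dots> \<le> C * (L' * norm (y - x))\<^sup>2 + L * (C' * (norm (y - x))\<^sup>2)"
      using assms(3,4) by (intro add_mono mult_left_mono power_mono f') auto
    finally show "norm (g (f y) - g (f x) - (g' (f x) \<circ> f' x) (y - x))
        \<le> (C * L'\<^sup>2 + L * C') * (norm (y - x))\<^sup>2"
      by (simp add: algebra_simps power_mult_distrib)
  qed
qed

lemma C11_id: "C11 1 0 (\<lambda>x. x)"
  by (rule C11I[of "\<lambda>x h. h"]) (auto intro: linear_id[unfolded id_def])

lemma C11_const: "C11 0 0 (\<lambda>x. c)"
  by (rule C11I[of "\<lambda>x h. 0"]) (auto intro: linear_zero)

lemma C11_scaleR:
  assumes "C11 L C f" shows "C11 (\<bar>c\<bar> * L) (\<bar>c\<bar> * C) (\<lambda>x. c *\<^sub>R f x)"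
proof -
  from assms obtain f' where f': "\<And>x. linear (f' x)" "\<And>x h. norm (f' x h) \<le> L * norm h"
    "\<And>x y. norm (f y - f x) \<le> L * norm (y - x)"
    "\<And>x y. norm (f y - f x - f' x (y - x)) \<le> C * (norm (y - x))\<^sup>2" by (rule C11E) blast
  have eq: "c *\<^sub>R f y - c *\<^sub>R f x = c *\<^sub>R (f y - f x)"
    "c *\<^sub>R f y - c *\<^sub>R f x - c *\<^sub>R f' x h = c *\<^sub>R (f y - f x - f' x h)" for x y h
    by (simp_all add: algebra_simps)
  show ?thesis
  proof (rule C11I[of "\<lambda>x h. c *\<^sub>R f' x h"])
    fix x y h
    show "linear (\<lambda>h. c *\<^sub>R f' x h)" by (intro linear_compose_scale_right f')
    show "norm (c *\<^sub>R f' x h) \<le> \<bar>c\<bar> * L * norm h"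
      "norm (c *\<^sub>R f y - c *\<^sub>R f x) \<le> \<bar>c\<bar> * L * norm (y - x)"
      unfolding eq(1) norm_scaleR mult.assoc by (intro mult_left_mono f' abs_ge_zero)+
    show "norm (c *\<^sub>R f y - c *\<^sub>R f x - c *\<^sub>R f' x (y - x)) \<le> \<bar>c\<bar> * C * (norm (y - x))\<^sup>2"
      unfolding eq(2) norm_scaleR mult.assoc by (intro mult_left_mono f' abs_ge_zero)
  qed
qed

lemma C11_add:
  assumes f: "C11 L C f" and g: "C11 L' C' g" shows "C11 (L + L') (C + C') (\<lambda>x. f x + g x)"
proof -
  from f obtain f' where f': "\<And>x. linear (f' x)" "\<And>x h. norm (f' x h) \<le> L * norm h"
    "\<And>x y. norm (f y - f x) \<le> L * norm (y - x)"
    "\<And>x y. norm (f y - f x - f' x (y - x)) \<le> C * (norm (y - x))\<^sup>2" by (rule C11E) blast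
  from g obtain g' where g': "\<And>x. linear (g' x)" "\<And>x h. norm (g' x h) \<le> L' * norm h"
    "\<And>x y. norm (g y - g x) \<le> L' * norm (y - x)"
    "\<And>x y. norm (g y - g x - g' x (y - x)) \<le> C' * (norm (y - x))\<^sup>2" by (rule C11E) blast
  have eq: "f y + g y - (f x + g x) = (f y - f x) + (g y - g x)"
    "f y + g y - (f x + g x) - (f' x h + g' x h) = (f y - f x - f' x h) + (g y - g x - g' x h)"
    for x y h by simp_all
  show ?thesis
  proof (rule C11I[of "\<lambda>x h. f' x h + g' x h"])
    fix x y h
    show "linear (\<lambda>h. f' x h + g' x h)" by (intro linear_compose_add f' g')
    show "norm (f' x h + g' x h) \<le> (L + L') * norm h"
      "norm (f y + g y - (f x + g x)) \<le> (L + L') * norm (y - x)"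
      unfolding eq(1) distrib_right by (intro norm_triangle_le add_mono f' g')+
    show "norm (f y + g y - (f x + g x) - (f' x (y - x) + g' x (y - x))) \<le> (C + C') * (norm (y - x))\<^sup>2"
      unfolding eq(2) distrib_right by (intro norm_triangle_le add_mono f' g')
  qed
qed

text \<open>The bounds by 1 keep the factors themselves out of the constants; \<open>L * L'\<close>
  comes from the product of the two increments, which is already of second order.\<close>

lemma C11_mult_real:
  fixes f g :: "'a::real_normed_vector \<Rightarrow> real"
  assumes f: "C11 L C f" and g: "C11 L' C' g" and "0 \<le> L" "0 \<le> L'"
    and bf: "\<And>x. \<bar>f x\<bar> \<le> 1" and bg: "\<And>x. \<bar>g x\<bar> \<le> 1"
  shows "C11 (L + L') (C + C' + L * L') (\<lambda>x. f x * g x)"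
proof -
  from f obtain f' where f': "\<And>x. linear (f' x)" "\<And>x h. norm (f' x h) \<le> L * norm h"
    "\<And>x y. norm (f y - f x) \<le> L * norm (y - x)"
    "\<And>x y. norm (f y - f x - f' x (y - x)) \<le> C * (norm (y - x))\<^sup>2" by (rule C11E) blast
  from g obtain g' where g': "\<And>x. linear (g' x)" "\<And>x h. norm (g' x h) \<le> L' * norm h"
    "\<And>x y. norm (g y - g x) \<le> L' * norm (y - x)"
    "\<And>x y. norm (g y - g x - g' x (y - x)) \<le> C' * (norm (y - x))\<^sup>2" by (rule C11E) blast
  have shrink: "\<bar>u * v\<bar> \<le> K" if "\<bar>u\<bar> \<le> 1" "\<bar>v\<bar> \<le> K" for u v K :: real
    using mult_mono[OF that] by (simp add: abs_mult)
  show ?thesis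
  proof (rule C11I[of "\<lambda>x h. f x * g' x h + g x * f' x h"])
    fix x y h
    show "linear (\<lambda>h. f x * g' x h + g x * f' x h)"
      using linear_compose_scale_right[OF g'(1), of "f x" x]
        linear_compose_scale_right[OF f'(1), of "g x" x]
      by (intro linear_compose_add) simp_all
    have "\<bar>f x * g' x h\<bar> \<le> L' * norm h" "\<bar>g x * f' x h\<bar> \<le> L * norm h"
      using f'(2) g'(2) by (auto intro!: shrink bf bg)
    then show "norm (f x * g' x h + g x * f' x h) \<le> (L + L') * norm h"
      unfolding add.commute[of L] distrib_right by (intro norm_triangle_le add_mono) simp_all
    have "\<bar>f y * (g y - g x)\<bar> \<le> L' * norm (y - x)" "\<bar>g x * (f y - f x)\<bar> \<le> L * norm (y - x)"
      using f'(3)[of y x] g'(3)[of y x] by (auto intro!: shrink bf bg)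
    then have "norm (f y * (g y - g x) + g x * (f y - f x)) \<le> L' * norm (y - x) + L * norm (y - x)"
      by (intro norm_triangle_le add_mono) simp_all
    moreover have "f y * g y - f x * g x = f y * (g y - g x) + g x * (f y - f x)"
      by (simp add: algebra_simps)
    ultimately show "norm (f y * g y - f x * g x) \<le> (L + L') * norm (y - x)"
      by (simp only: distrib_right add.commute)
    have "\<bar>f x * (g y - g x - g' x (y - x))\<bar> \<le> C' * (norm (y - x))\<^sup>2"
      "\<bar>g x * (f y - f x - f' x (y - x))\<bar> \<le> C * (norm (y - x))\<^sup>2"
      using f'(4)[of y x] g'(4)[of y x] by (auto intro!: shrink bf bg)
    moreover have "\<bar>(f y - f x) * (g y - g x)\<bar> \<le> (L * norm (y - x)) * (L' * norm (y - x))"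
      unfolding abs_mult using f'(3)[of y x] g'(3)[of y x] assms by (intro mult_mono) auto
    ultimately have "norm (f x * (g y - g x - g' x (y - x)) + g x * (f y - f x - f' x (y - x))
        + (f y - f x) * (g y - g x)) \<le> C' * (norm (y - x))\<^sup>2 + C * (norm (y - x))\<^sup>2
        + (L * norm (y - x)) * (L' * norm (y - x))"
      by (intro norm_triangle_le add_mono) simp_all
    moreover have "f y * g y - f x * g x - (f x * g' x (y - x) + g x * f' x (y - x)) =
       f x * (g y - g x - g' x (y - x)) + g x * (f y - f x - f' x (y - x)) + (f y - f x) * (g y - g x)"
      by (simp add: algebra_simps)
    ultimately show "norm (f y * g y - f x * g x - (f x * g' x (y - x) + g x * f' x (y - x)))
        \<le> (C + C' + L * L') * (norm (y - x))\<^sup>2"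
      by (simp only: power2_eq_square) (simp add: algebra_simps)
  qed
qed

lemma C11_prod:
  fixes f :: "'i \<Rightarrow> 'a::real_normed_vector \<Rightarrow> real"
  assumes "finite I" "\<And>i. i \<in> I \<Longrightarrow> \<exists>L\<ge>0. \<exists>C. C11 L C (f i)" "\<And>i x. \<bar>f i x\<bar> \<le> 1"
  shows "\<exists>L\<ge>0. \<exists>C. C11 L C (\<lambda>x. \<Prod>i\<in>I. f i x)"
  using assms(1,2)
proof induction
  case empty
  show ?case using C11_const[of "1::real"] by auto
next
  case (insert i I)
  obtain L C where 1: "0 \<le> L" "C11 L C (\<lambda>x. \<Prod>i\<in>I. f i x)" using insert by auto
  obtain L' C' where 2: "0 \<le> L'" "C11 L' C' (f i)" using insert by blast
  have "\<bar>\<Prod>i\<in>I. f i x\<bar> \<le> 1" for x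
    unfolding abs_prod using assms(3) by (intro prod_le_1) auto
  from C11_mult_real[OF 2(2) 1(2) 2(1) 1(1) assms(3) this] insert(1,2) 1(1) 2(1)
  show ?case by (intro exI[of _ "L' + L"] conjI exI[of _ "C' + C + L' * L"]) auto
qed

lemma C11_real:
  fixes f :: "real \<Rightarrow> real"
  assumes d: "\<And>x. (f has_real_derivative f' x) (at x)" "\<And>x. (f' has_real_derivative f'' x) (at x)"
    and b: "\<And>x. \<bar>f' x\<bar> \<le> L" "\<And>x. \<bar>f'' x\<bar> \<le> C"
  shows "C11 L C f"
proof (rule C11I[of "\<lambda>x h. f' x * h"])
  fix x y h
  show "linear (\<lambda>h. f' x * h)" by (simp add: linear_times)
  show "norm (f' x * h) \<le> L * norm h" using b by (simp add: abs_mult mult_right_mono)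
  have *: "norm (f v - f u) \<le> L * norm (v - u)"
    if "\<And>x. (f has_real_derivative f' x) (at x)" "\<And>x. \<bar>f' x\<bar> \<le> L"
    for f f' :: "real \<Rightarrow> real" and u v L
    using that by (intro field_differentiable_bound[of UNIV f f' L]) auto
  show "norm (f y - f x) \<le> L * norm (y - x)" by (rule *[OF d(1) b(1)])
  have 0: "0 \<le> C" using b(2)[of 0] by linarith
  \<comment> \<open>The mean value inequality is applied to
    \<open>z \<mapsto> f z - f' x * z\<close>, whose derivative \<open>f' z - f' x\<close> is at
    most \<open>C * norm (y - x)\<close> on the segment.\<close>
  have "norm ((f y - f' x * y) - (f x - f' x * x)) \<le> (C * norm (y - x)) * norm (y - x)"
  proof (rule field_differentiable_bound[of "closed_segment x y" _ "\<lambda>z. f' z - f' x"])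
    fix z assume z: "z \<in> closed_segment x y"
    show "((\<lambda>z. f z - f' x * z) has_field_derivative f' z - f' x) (at z within closed_segment x y)"
      by (auto intro!: derivative_eq_intros has_field_derivative_at_within[OF d(1)])
    have "norm (f' z - f' x) \<le> C * norm (z - x)" by (rule *[OF d(2) b(2)])
    also have "\<dots> \<le> C * norm (y - x)"
      using segment_bound1[OF z] 0 by (intro mult_left_mono) auto
    finally show "norm (f' z - f' x) \<le> C * norm (y - x)" .
  qed auto
  then show "norm (f y - f x - f' x * (y - x)) \<le> C * (norm (y - x))\<^sup>2"
    by (simp add: algebra_simps power2_eq_square)
qed

section \<open>Determining a measure by smooth functions\<close>

text \<open>Its derivative is the polynomial \<open>s * (1 - s)\<close> in the function itself, so
  the bounds on the first two derivatives follow from \<open>0 < s\<close> and \<open>s < 1\<close>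
  alone.\<close>

definition sigmoid :: "real \<Rightarrow> real" where
  "sigmoid x = 1 / (1 + exp (- x))"

lemma sigmoid_bounds: "0 < sigmoid x" "sigmoid x < 1"
  by (simp_all add: sigmoid_def add_pos_pos)

lemma sigmoid_deriv: "(sigmoid has_real_derivative sigmoid x * (1 - sigmoid x)) (at x)"
proof -
  have "1 + exp (- x) \<noteq> 0" using exp_gt_zero[of "- x"] by linarith
  then show ?thesis
    unfolding sigmoid_def[abs_def]
    by (auto intro!: derivative_eq_intros simp: divide_simps power2_eq_square)
qed

lemma C11_sigmoid: "C11 1 1 sigmoid"
proof (rule C11_real[OF sigmoid_deriv])
  fix x
  show "((\<lambda>x. sigmoid x * (1 - sigmoid x)) has_real_derivative
      sigmoid x * (1 - sigmoid x) * (1 - 2 * sigmoid x)) (at x)"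
    by (auto intro!: derivative_eq_intros sigmoid_deriv simp: algebra_simps)
  have *: "\<bar>s * (1 - s)\<bar> \<le> 1" if "0 < s" "s < 1" for s :: real
    unfolding abs_mult using that by (intro mult_le_one) auto
  show "\<bar>sigmoid x * (1 - sigmoid x)\<bar> \<le> 1" by (intro * sigmoid_bounds)
  then show "\<bar>sigmoid x * (1 - sigmoid x) * (1 - 2 * sigmoid x)\<bar> \<le> 1"
    unfolding abs_mult[of "sigmoid x * (1 - sigmoid x)"] using sigmoid_bounds[of x]
    by (intro mult_le_one) auto
qed

lemma sigmoid_at_top: "(sigmoid \<longlongrightarrow> 1) at_top"
proof -
  have "((\<lambda>x::real. exp (- x)) \<longlongrightarrow> 0) at_top"
    by (rule filterlim_compose[OF exp_at_bot filterlim_uminus_at_bot_at_top])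
  from tendsto_divide[OF tendsto_const[of 1] tendsto_add[OF tendsto_const[of 1] this]]
  show ?thesis by (simp add: sigmoid_def[abs_def])
qed

lemma sigmoid_at_bot: "(sigmoid \<longlongrightarrow> 0) at_bot"
proof (rule tendsto_sandwich[where f = "\<lambda>_. 0" and h = exp])
  show "(exp \<longlongrightarrow> (0::real)) at_bot" by (rule exp_at_bot)
  have "sigmoid x \<le> exp x" for x
    by (simp add: sigmoid_def divide_simps add_pos_pos algebra_simps flip: exp_add)
  then show "\<forall>\<^sub>F x in at_bot. sigmoid x \<le> exp x" by simp
  show "\<forall>\<^sub>F x in at_bot. 0 \<le> sigmoid x" using sigmoid_bounds(1) by (simp add: less_imp_le)
qed simp

text \<open>The shift by \<open>n\<close> decides the boundary case: at \<open>r = 0\<close> the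
  argument tends to minus infinity, so the limit is the indicator of the open half-line, while the
  slope \<open>n ^ 2\<close> still wins for every \<open>r > 0\<close>.\<close>

definition smooth_step :: "nat \<Rightarrow> real \<Rightarrow> real" where
  "smooth_step n r = sigmoid (real n ^ 2 * r - real n)"

lemma smooth_step_tendsto: "(\<lambda>n. smooth_step n r) \<longlonglongrightarrow> (if r > 0 then 1 else 0)"
proof (cases "r > 0")
  case True
  have "filterlim (\<lambda>n. - 1 + r * real n) at_top sequentially"
    using True by (intro filterlim_tendsto_add_at_top[OF tendsto_const]
        filterlim_tendsto_pos_mult_at_top[OF tendsto_const] filterlim_real_sequentially)
  then have "filterlim (\<lambda>n. real n * (- 1 + r * real n)) at_top sequentially"
    by (intro filterlim_at_top_mult_at_top filterlim_real_sequentially)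
  then have "filterlim (\<lambda>n. real n ^ 2 * r - real n) at_top sequentially"
    by (simp add: algebra_simps power2_eq_square)
  from filterlim_compose[OF sigmoid_at_top this] True
  show ?thesis by (simp add: smooth_step_def)
next
  case False
  have "filterlim (\<lambda>n. real n ^ 2 * r - real n) at_bot sequentially"
  proof (rule filterlim_at_bot_mono)
    show "filterlim (\<lambda>n. - real n) at_bot sequentially"
      by (rule filterlim_compose[OF filterlim_uminus_at_bot_at_top filterlim_real_sequentially])
    show "\<forall>\<^sub>F n in sequentially. real n ^ 2 * r - real n \<le> - real n"
      using False by (simp add: mult_nonneg_nonpos)
  qed
  from filterlim_compose[OF sigmoid_at_bot this] False
  show ?thesis by (simp add: smooth_step_def)
qed

lemma C11_smooth_step_affine:
  fixes w :: "'a::euclidean_space"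
  shows "\<exists>L\<ge>0. \<exists>C. C11 L C (\<lambda>x. smooth_step n (x \<bullet> w + c))"
proof -
  have "C11 (real n ^ 2 * norm w) 0 (\<lambda>x. real n ^ 2 * (x \<bullet> w + c) - real n)"
  proof (rule C11I[of "\<lambda>x h. real n ^ 2 * (h \<bullet> w)"])
    fix x y h :: 'a
    show "linear (\<lambda>h. real n ^ 2 * (h \<bullet> w))"
      by (rule linearI) (simp_all add: inner_add_left algebra_simps)
    have *: "norm (real n ^ 2 * (h \<bullet> w)) \<le> real n ^ 2 * norm w * norm h" for h
      using Cauchy_Schwarz_ineq2[of h w]
      by (auto simp: abs_mult mult.assoc mult.commute[of "norm w"] intro!: mult_left_mono)
    then show "norm (real n ^ 2 * (h \<bullet> w)) \<le> real n ^ 2 * norm w * norm h" .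
    have eq: "real n ^ 2 * (y \<bullet> w + c) - real n - (real n ^ 2 * (x \<bullet> w + c) - real n)
        = real n ^ 2 * ((y - x) \<bullet> w)" by (simp add: algebra_simps)
    show "norm (real n ^ 2 * (y \<bullet> w + c) - real n - (real n ^ 2 * (x \<bullet> w + c) - real n))
        \<le> real n ^ 2 * norm w * norm (y - x)" unfolding eq by (rule *)
    show "norm (real n ^ 2 * (y \<bullet> w + c) - real n - (real n ^ 2 * (x \<bullet> w + c) - real n)
        - real n ^ 2 * ((y - x) \<bullet> w)) \<le> 0 * (norm (y - x))\<^sup>2" unfolding eq by simp
  qed
  from C11_compose[OF C11_sigmoid this]
  show ?thesis
    unfolding smooth_step_def by (intro exI[of _ "1 * (real n ^ 2 * norm w)"] conjI exI) auto
qed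

text \<open>A product of smooth steps, one for each face of an open box, is bounded by 1 and
  converges pointwise to the indicator of the box. Dominated convergence gives agreement on open
  boxes, which form an intersection-stable generator of the Borel sets.\<close>

lemma measure_eqI_C11:
  fixes \<mu> \<mu>' :: "'a::euclidean_space measure"
  assumes "prob_space \<mu>" "prob_space \<mu>'" and sets: "sets \<mu> = sets borel" "sets \<mu>' = sets borel"
    and eq: "\<And>f L C. C11 L C f \<Longrightarrow> (\<And>x. \<bar>f x\<bar> \<le> (1::real)) \<Longrightarrow> (\<integral>x. f x \<partial>\<mu>) = (\<integral>x. f x \<partial>\<mu>')"
  shows "\<mu> = \<mu>'"
proof -
  interpret A: prob_space \<mu> by fact
  interpret B: prob_space \<mu>' by fact
  note [measurable_cong] = sets
  have box: "emeasure \<mu> (box l u) = emeasure \<mu>' (box l u)" for l u :: 'a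
  proof -
    define f where "f n x = (\<Prod>i\<in>Basis. smooth_step n (x \<bullet> i + (- (l \<bullet> i))) * smooth_step n (x \<bullet> (- i) + u \<bullet> i))"
      for n :: nat and x :: 'a
    have s1: "\<bar>smooth_step n r\<bar> \<le> 1" for n r
      using sigmoid_bounds[of "real n ^ 2 * r - real n"] unfolding smooth_step_def by linarith
    then have s2: "\<bar>smooth_step n r * smooth_step n r'\<bar> \<le> 1" for n r r'
      unfolding abs_mult by (intro mult_le_one) auto
    have "\<exists>L\<ge>0. \<exists>C. C11 L C (\<lambda>x. smooth_step n (x \<bullet> i + (- (l \<bullet> i))) * smooth_step n (x \<bullet> (- i) + u \<bullet> i))" for n i
    proof -
      obtain L C L' C' where "0 \<le> L" "C11 L C (\<lambda>x. smooth_step n (x \<bullet> i + (- (l \<bullet> i))))"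
        "0 \<le> L'" "C11 L' C' (\<lambda>x. smooth_step n (x \<bullet> (- i) + u \<bullet> i))"
        using C11_smooth_step_affine by blast
      from C11_mult_real[OF this(2,4,1,3) s1 s1] \<open>0 \<le> L\<close> \<open>0 \<le> L'\<close> show ?thesis
        by (intro exI[of _ "L + L'"] conjI exI) auto
    qed
    from C11_prod[OF finite_Basis this s2]
    have C11: "\<exists>L\<ge>0. \<exists>C. C11 L C (f n)" for n by (simp add: f_def[abs_def])
    have f1: "\<bar>f n x\<bar> \<le> 1" for n x
      unfolding f_def abs_prod using s2 by (intro prod_le_1) auto
    have [measurable]: "f n \<in> borel_measurable borel" for n
      using C11[of n] by (blast intro: borel_measurable_continuous_onI C11_continuous_on)
    have lim: "(\<lambda>n. f n x) \<longlonglongrightarrow> indicator (box l u) x" for x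
    proof -
      have "(\<lambda>n. f n x) \<longlonglongrightarrow> (\<Prod>i\<in>Basis. (if x \<bullet> i + (- (l \<bullet> i)) > 0 then 1 else 0) * 
          (if x \<bullet> (- i) + u \<bullet> i > 0 then 1 else 0))"
        unfolding f_def by (intro tendsto_prod tendsto_mult smooth_step_tendsto)
      also have "(\<Prod>i\<in>Basis. (if x \<bullet> i + (- (l \<bullet> i)) > 0 then 1 else 0) * 
          (if x \<bullet> (- i) + u \<bullet> i > 0 then 1 else 0)) = (indicator (box l u) x :: real)"
      proof (cases "x \<in> box l u")
        case True
        then show ?thesis by (auto simp: mem_box intro!: prod.neutral)
      next
        case False
        then obtain i where "i \<in> Basis" "\<not> (l \<bullet> i < x \<bullet> i \<and> x \<bullet> i < u \<bullet> i)" by (auto simp: mem_box)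
        then show ?thesis using False by (auto intro!: prod_zero bexI[of _ i])
      qed
      finally show ?thesis .
    qed
    have "(\<lambda>n. \<integral>x. f n x \<partial>\<mu>) \<longlonglongrightarrow> (\<integral>x. indicator (box l u) x \<partial>\<mu>)"
      by (rule integral_dominated_convergence[where w = "\<lambda>_. 1"]) (auto intro: lim f1)
    moreover have "(\<lambda>n. \<integral>x. f n x \<partial>\<mu>') \<longlonglongrightarrow> (\<integral>x. indicator (box l u) x \<partial>\<mu>')"
      by (rule integral_dominated_convergence[where w = "\<lambda>_. 1"]) (auto intro: lim f1)
    moreover have "(\<integral>x. f n x \<partial>\<mu>) = (\<integral>x. f n x \<partial>\<mu>')" for n
    proof -
      obtain L C where "C11 L C (f n)" using C11 by blast
      from eq[OF this f1] show ?thesis .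
    qed
    ultimately have "(\<integral>x. indicator (box l u) x \<partial>\<mu>) = ((\<integral>x. indicator (box l u) x \<partial>\<mu>') :: real)"
      by (auto intro: LIMSEQ_unique)
    then show ?thesis by (simp add: A.emeasure_eq_measure B.emeasure_eq_measure)
  qed
  let ?E = "range (\<lambda>(l, u). box l u :: 'a set)"
  show ?thesis
  proof (rule measure_eqI_generator_eq)
    show "Int_stable ?E" by (auto simp: Int_stable_def box_Int_box)
    show "?E \<subseteq> Pow UNIV" "sets \<mu> = sigma_sets UNIV ?E" "sets \<mu>' = sigma_sets UNIV ?E"
      by (simp_all add: borel_eq_box sets)
    let ?A = "\<lambda>n::nat. box (- (real n *\<^sub>R One)) (real n *\<^sub>R One) :: 'a set"
    show "range ?A \<subseteq> ?E" "(\<Union>i. ?A i) = UNIV" unfolding UN_box_eq_UNIV by auto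
    show "emeasure \<mu> X = emeasure \<mu>' X" if "X \<in> ?E" for X using that box by auto
    show "emeasure \<mu> (?A i) \<noteq> \<infinity>" for i by simp
  qed
qed

section \<open>Exponential tilting\<close>

lemma exp_minus_one_bounds:
  fixes s :: real
  assumes "\<bar>s\<bar> \<le> 1"
  shows "\<bar>exp s - 1 - s\<bar> \<le> s\<^sup>2" "\<bar>exp s - 1\<bar> \<le> 2 * \<bar>s\<bar>"
proof -
  have "exp s \<le> 1 + s + s\<^sup>2"
  proof (cases "s \<ge> 0")
    case True then show ?thesis using exp_bound assms by auto
  next
    case False
    \<comment> \<open>For negative \<open>s\<close> the factor \<open>1 - s\<close> is positive, and
      \<open>(1 - s) * (1 + s + s\<^sup>2) = 1 - s ^ 3\<close> is at least 1.\<close>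
    have "(1 - s) * exp s \<le> exp (- s) * exp s"
      using exp_ge_add_one_self[of "- s"] by (intro mult_right_mono) auto
    also have "\<dots> = 1" by (simp flip: exp_add)
    also have "1 \<le> (1 - s) * (1 + s + s\<^sup>2)"
    proof -
      have "(1 - s) * (1 + s + s\<^sup>2) = 1 + (- s) ^ 3"
        by (simp add: algebra_simps power2_eq_square power3_eq_cube)
      then show ?thesis using False by simp
    qed
    finally show ?thesis using False by simp
  qed
  then show 1: "\<bar>exp s - 1 - s\<bar> \<le> s\<^sup>2" using exp_ge_add_one_self[of s] by linarith
  have "s\<^sup>2 \<le> \<bar>s\<bar>" using mult_left_le[of "\<bar>s\<bar>" "\<bar>s\<bar>"] assms
    by (simp add: power2_eq_square flip: abs_mult)
  then show "\<bar>exp s - 1\<bar> \<le> 2 * \<bar>s\<bar>" using 1 by linarith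
qed

lemma (in finite_measure) integrable_scaleR_exp:
  fixes q :: "'a \<Rightarrow> 'b::{banach, second_countable_topology}"
  assumes "q \<in> borel_measurable M" "s \<in> borel_measurable M"
    and "AE y in M. norm (q y) \<le> R" "AE y in M. \<bar>s y\<bar> \<le> (S::real)"
  shows "integrable M (\<lambda>y. exp (s y) *\<^sub>R q y)"
proof (rule integrable_const_bound[where B = "exp S * R"])
  show "AE y in M. norm (exp (s y) *\<^sub>R q y) \<le> exp S * R"
    using assms(3,4) by eventually_elim (auto intro!: mult_mono)
qed (use assms in measurable)

text \<open>Centring \<open>q\<close> at its mean turns the difference of means into one integral of
  \<open>exp (s y)\<close> against a function with mean zero, so the zeroth-order term of the
  exponential drops out. The linear term that survives is the covariance of \<open>s\<close> and
  \<open>q\<close>. The bounds hold for every \<open>S\<close>: for \<open>S > 1\<close> the trivial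
  estimates by multiples of \<open>R\<close> already suffice.\<close>

lemma (in prob_space) exp_tilt:
  fixes q :: "'a \<Rightarrow> 'b::{banach, second_countable_topology}"
  assumes [measurable]: "q \<in> borel_measurable M" "s \<in> borel_measurable M"
    and q: "AE y in M. norm (q y) \<le> R" and s: "AE y in M. \<bar>s y\<bar> \<le> S"
  defines "r \<equiv> (\<integral>y. exp (s y) *\<^sub>R q y \<partial>M) /\<^sub>R (\<integral>y. exp (s y) \<partial>M)"
  shows "norm (r - (\<integral>y. q y \<partial>M)) \<le> 12 * R * S"
    and "norm (r - (\<integral>y. q y \<partial>M) - ((\<integral>y. s y *\<^sub>R q y \<partial>M) - (\<integral>y. s y \<partial>M) *\<^sub>R (\<integral>y. q y \<partial>M)))
           \<le> 18 * R * S\<^sup>2"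
proof -
  have "AE y in M. 0 \<le> R" using q by eventually_elim (rule order.trans[OF norm_ge_zero])
  then have "0 \<le> R" by (simp add: AE_const)
  have "AE y in M. 0 \<le> S" using s by eventually_elim (rule order.trans[OF abs_ge_zero])
  then have "0 \<le> S" by (simp add: AE_const)
  have bnd: "norm (\<integral>y. f y \<partial>M) \<le> B" if "AE y in M. norm (f y) \<le> B" "f \<in> borel_measurable M"
    for f :: "'a \<Rightarrow> 'c::{banach, second_countable_topology}" and B
  proof -
    have "integrable M f" using that by (rule integrable_const_bound)
    then have "norm (\<integral>y. f y \<partial>M) \<le> (\<integral>y. norm (f y) \<partial>M)" by simp
    also have "\<dots> \<le> (\<integral>y. B \<partial>M)"
      using that \<open>integrable M f\<close> by (intro integral_mono_AE) auto
    finally show ?thesis by (simp add: prob_space)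
  qed
  have nsc: "norm (c *\<^sub>R x) \<le> A * B" if "\<bar>c\<bar> \<le> A" "norm x \<le> B" for c A B and x :: 'b
    using mult_mono[OF that] order.trans[OF abs_ge_zero that(1)] by simp
  define e where "e = (\<integral>y. exp (s y) \<partial>M)"
  define m where "m = (\<integral>y. q y \<partial>M)"
  define q0 where "q0 y = q y - m" for y
  have [measurable]: "q0 \<in> borel_measurable M" unfolding q0_def by measurable
  have m: "norm m \<le> R" unfolding m_def by (rule bnd) (use q in auto)
  have q0: "AE y in M. norm (q0 y) \<le> 2 * R"
    using q by eventually_elim (use m in \<open>auto simp: q0_def intro: order.trans[OF norm_triangle_ineq4]\<close>)
  have iq: "integrable M q" by (rule integrable_const_bound[OF q]) simp
  have is0: "integrable M s" by (rule integrable_const_bound[where B=S]) (use s in auto)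
  have ie: "integrable M (\<lambda>y. exp (s y))"
    using integrable_scaleR_exp[of "\<lambda>_. 1::real" s 1 S] s by simp
  have ieq: "integrable M (\<lambda>y. exp (s y) *\<^sub>R q y)"
    using q s by (intro integrable_scaleR_exp[of q s R S]) auto
  have isq: "integrable M (\<lambda>y. s y *\<^sub>R q y)"
  proof (rule integrable_const_bound[where B="S * R"])
    show "AE y in M. norm (s y *\<^sub>R q y) \<le> S * R"
      using q s by eventually_elim (rule nsc; simp)
  qed simp
  have e_ge: "exp (- S) \<le> e"
  proof -
    have "(\<integral>y. exp (- S) \<partial>M) \<le> e" unfolding e_def
      by (rule integral_mono_AE[OF _ ie]) (use s in \<open>auto elim!: eventually_mono\<close>)
    then show ?thesis by (simp add: prob_space)
  qed
  then have "e > 0" using exp_gt_zero[of "- S"] by linarith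
  \<comment> \<open>For \<open>S \<le> 1\<close> the normalizing constant is at least
    \<open>exp (- 1)\<close>, hence at least 1/3. The factor 3 enters both final constants: 12 is 3
    times 2 times 2, and 18 is 3 times the sum of 2 and 4.\<close>
  have e_third: "1 / e \<le> 3" if "S \<le> 1"
  proof -
    have "1 / 3 \<le> 1 / exp (1::real)" using exp_le by (intro divide_left_mono) auto
    also have "\<dots> = exp (-1)" by (simp add: exp_minus divide_inverse)
    also have "\<dots> \<le> exp (- S)" using that by simp
    finally have "1 / 3 \<le> e" using e_ge by simp
    then show ?thesis using \<open>e > 0\<close> by (simp add: field_simps)
  qed
  have int_q0: "(\<integral>y. f y *\<^sub>R q0 y \<partial>M) = (\<integral>y. f y *\<^sub>R q y \<partial>M) - (\<integral>y. f y \<partial>M) *\<^sub>R m"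
    if "integrable M f" "integrable M (\<lambda>y. f y *\<^sub>R q y)" for f :: "'a \<Rightarrow> real"
    using that by (simp add: q0_def scaleR_diff_right)
  have r0: "r - m = (1 / e) *\<^sub>R (\<integral>y. exp (s y) *\<^sub>R q0 y \<partial>M)"
    using \<open>e > 0\<close> by (simp add: int_q0[OF ie ieq] r_def e_def[symmetric] scaleR_diff_right divide_inverse)
  have z0: "(\<integral>y. q0 y \<partial>M) = 0" unfolding q0_def using iq by (simp add: m_def prob_space)
  have c0: "(\<integral>y. s y *\<^sub>R q y \<partial>M) - (\<integral>y. s y \<partial>M) *\<^sub>R m = (\<integral>y. s y *\<^sub>R q0 y \<partial>M)"
    by (simp add: int_q0[OF is0 isq])
  have iq0: "integrable M q0" by (rule integrable_const_bound[OF q0]) simp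
  have ieq0: "integrable M (\<lambda>y. exp (s y) *\<^sub>R q0 y)"
    using q0 s by (intro integrable_scaleR_exp[of q0 s "2 * R" S]) auto
  have isq0: "integrable M (\<lambda>y. s y *\<^sub>R q0 y)"
    unfolding q0_def scaleR_diff_right using isq is0 by auto
  have nsq0: "norm (\<integral>y. s y *\<^sub>R q0 y \<partial>M) \<le> S * (2 * R)"
  proof (rule bnd)
    show "AE y in M. norm (s y *\<^sub>R q0 y) \<le> S * (2 * R)"
      using q0 s by eventually_elim (rule nsc; simp)
  qed simp
  \<comment> \<open>No smallness of \<open>S\<close> is involved: the weight is positive, so its
    integral cancels against the normalization.\<close>
  have rm_big: "norm (r - m) \<le> 2 * R"
  proof -
    have "norm (\<integral>y. exp (s y) *\<^sub>R q0 y \<partial>M) \<le> (\<integral>y. norm (exp (s y) *\<^sub>R q0 y) \<partial>M)"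
      by (rule integral_norm_bound)
    also have "\<dots> \<le> (\<integral>y. exp (s y) * (2 * R) \<partial>M)"
      using integrable_norm[OF ieq0] ie q0 by (intro integral_mono_AE) (auto elim: eventually_mono)
    finally show ?thesis unfolding r0 using \<open>e > 0\<close> by (simp add: e_def[symmetric] field_simps)
  qed
  have small: "AE y in M. \<bar>exp (s y) - 1\<bar> \<le> 2 * S \<and> \<bar>exp (s y) - 1 - s y\<bar> \<le> S\<^sup>2" if "S \<le> 1"
    using s
  proof eventually_elim
    case (elim y)
    then have "\<bar>s y\<bar> \<le> 1" using that by simp
    moreover have "(s y)\<^sup>2 \<le> S\<^sup>2" using power_mono[OF elim, of 2] by simp
    ultimately show ?case using exp_minus_one_bounds[of "s y"] elim by auto
  qed
  have scale: "norm ((1 / e) *\<^sub>R x) \<le> 3 * B" if "norm x \<le> B" "S \<le> 1" for x :: 'b and B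
    using mult_mono[OF e_third[OF that(2)] that(1)] \<open>e > 0\<close> by simp
  show "norm (r - (\<integral>y. q y \<partial>M)) \<le> 12 * R * S"
  proof (cases "S \<le> 1")
    case True
    have "(\<integral>y. exp (s y) *\<^sub>R q0 y \<partial>M) = (\<integral>y. (exp (s y) - 1) *\<^sub>R q0 y \<partial>M)"
      using ieq0 iq0 z0 by (simp add: scaleR_diff_left)
    also have "norm \<dots> \<le> (2 * S) * (2 * R)"
    proof (rule bnd)
      show "AE y in M. norm ((exp (s y) - 1) *\<^sub>R q0 y) \<le> (2 * S) * (2 * R)"
        using small[OF True] q0 by eventually_elim (rule nsc; simp)
    qed simp
    finally have "norm (r - m) \<le> 3 * ((2 * S) * (2 * R))" unfolding r0 using True by (rule scale)
    then show ?thesis by (simp add: m_def mult_ac)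
  next
    case False
    then have "2 * R \<le> 12 * R * S" using \<open>0 \<le> R\<close> mult_left_mono[of 1 S R] by auto
    then show ?thesis using rm_big by (simp add: m_def)
  qed
  show "norm (r - (\<integral>y. q y \<partial>M) - ((\<integral>y. s y *\<^sub>R q y \<partial>M) - (\<integral>y. s y \<partial>M) *\<^sub>R (\<integral>y. q y \<partial>M)))
      \<le> 18 * R * S\<^sup>2"
    unfolding m_def[symmetric] c0
  proof (cases "S \<le> 1")
    case True
    \<comment> \<open>The covariance in the claim carries no factor \<open>1 / e\<close>, so
      normalization leaves the correction \<open>1 - e\<close> times the covariance. Both of these
      factors are of order \<open>S\<close>.\<close>
    have "(\<integral>y. (exp (s y) - 1 - s y) *\<^sub>R q0 y \<partial>M) + (1 - e) *\<^sub>R (\<integral>y. s y *\<^sub>R q0 y \<partial>M)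
        = (\<integral>y. exp (s y) *\<^sub>R q0 y \<partial>M) - e *\<^sub>R (\<integral>y. s y *\<^sub>R q0 y \<partial>M)"
      using ieq0 iq0 isq0 z0 by (simp add: scaleR_diff_left)
    then have "r - m - (\<integral>y. s y *\<^sub>R q0 y \<partial>M) = (1 / e) *\<^sub>R
        ((\<integral>y. (exp (s y) - 1 - s y) *\<^sub>R q0 y \<partial>M) + (1 - e) *\<^sub>R (\<integral>y. s y *\<^sub>R q0 y \<partial>M))"
      unfolding r0 using \<open>e > 0\<close> by (simp add: scaleR_diff_right)
    also have "norm \<dots> \<le> 3 * (S\<^sup>2 * (2 * R) + (2 * S) * (S * (2 * R)))"
    proof (rule scale[OF norm_triangle_le[OF add_mono] True])
      show "norm (\<integral>y. (exp (s y) - 1 - s y) *\<^sub>R q0 y \<partial>M) \<le> S\<^sup>2 * (2 * R)"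
      proof (rule bnd)
        show "AE y in M. norm ((exp (s y) - 1 - s y) *\<^sub>R q0 y) \<le> S\<^sup>2 * (2 * R)"
          using small[OF True] q0 by eventually_elim (rule nsc; simp)
      qed simp
      have "norm (\<integral>y. exp (s y) - 1 \<partial>M) \<le> 2 * S"
        by (rule bnd) (use small[OF True] in auto)
      then have "\<bar>1 - e\<bar> \<le> 2 * S" using ie by (simp add: e_def prob_space abs_minus_commute)
      then show "norm ((1 - e) *\<^sub>R (\<integral>y. s y *\<^sub>R q0 y \<partial>M)) \<le> (2 * S) * (S * (2 * R))"
        unfolding norm_scaleR using nsq0 \<open>0 \<le> S\<close> by (intro mult_mono) auto
    qed
    finally show "norm (r - m - (\<integral>y. s y *\<^sub>R q0 y \<partial>M)) \<le> 18 * R * S\<^sup>2"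
      by (simp add: power2_eq_square)
  next
    case False
    have "norm (r - m - (\<integral>y. s y *\<^sub>R q0 y \<partial>M)) \<le> 2 * R + S * (2 * R)"
      by (rule order.trans[OF norm_triangle_ineq4 add_mono[OF rm_big nsq0]])
    also have "\<dots> \<le> 18 * R * S\<^sup>2"
    proof -
      have "1 \<le> S\<^sup>2" using False by (intro one_le_power) simp
      moreover have "S \<le> S\<^sup>2" using False mult_left_mono[of 1 S S] by (simp add: power2_eq_square)
      ultimately have "R * 1 \<le> R * S\<^sup>2" "R * S \<le> R * S\<^sup>2"
        using \<open>0 \<le> R\<close> by (blast intro: mult_left_mono)+
      moreover have "0 \<le> R * S\<^sup>2" using \<open>0 \<le> R\<close> by simp
      ultimately show ?thesis by (simp add: algebra_simps)
    qed
    finally show "norm (r - m - (\<integral>y. s y *\<^sub>R q0 y \<partial>M)) \<le> 18 * R * S\<^sup>2" .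
  qed
qed

text \<open>Up to a factor not depending on \<open>y\<close>, the Gaussian likelihood
  \<open>exp (- (norm (x - q *\<^sub>R y))\<^sup>2 / (2 * p\<^sup>2))\<close> is such a weight, with \<open>\<xi> = (q / p\<^sup>2) *\<^sub>R x\<close> and
  \<open>\<beta> = q\<^sup>2 / (2 * p\<^sup>2)\<close>.\<close>

definition tilt_weight :: "'a::euclidean_space \<Rightarrow> real \<Rightarrow> 'a \<Rightarrow> real" where
  "tilt_weight \<xi> \<beta> y = exp (\<xi> \<bullet> y - \<beta> * (norm y)\<^sup>2)"

lemma borel_measurable_tilt_weight [measurable]: "tilt_weight \<xi> \<beta> \<in> borel_measurable borel"
  unfolding tilt_weight_def by measurable

lemma tilt_weight_pos: "0 < tilt_weight \<xi> \<beta> y"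
  by (simp add: tilt_weight_def)

lemma tilt_weight_add: "tilt_weight (\<xi> + \<eta>) (\<beta> + \<rho>) y = tilt_weight \<xi> \<beta> y * tilt_weight \<eta> \<rho> y"
  by (simp add: tilt_weight_def algebra_simps flip: exp_add)

definition tilt_mean :: "'a::euclidean_space measure \<Rightarrow> 'a \<Rightarrow> real \<Rightarrow> 'a" where
  "tilt_mean \<nu> \<xi> \<beta> = (\<integral>y. tilt_weight \<xi> \<beta> y *\<^sub>R y \<partial>\<nu>) /\<^sub>R (\<integral>y. tilt_weight \<xi> \<beta> y \<partial>\<nu>)"

section \<open>Bounded probability measures and their tilts\<close>

locale bounded_prob = prob_space \<nu> for \<nu> :: "'a::euclidean_space measure" +
  fixes R :: real
  assumes sets_eq [measurable_cong]: "sets \<nu> = sets borel"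
    and bounded: "AE y in \<nu>. norm y \<le> R"
begin

lemma R_nonneg: "0 \<le> R"
proof -
  have "AE y in \<nu>. 0 \<le> R" using bounded by eventually_elim (rule order.trans[OF norm_ge_zero])
  then show ?thesis by (simp add: AE_const)
qed

lemma exponent_bound: "AE y in \<nu>. \<bar>\<xi> \<bullet> y - \<beta> * (norm y)\<^sup>2\<bar> \<le> R * norm \<xi> + R\<^sup>2 * \<bar>\<beta>\<bar>"
  using bounded
proof eventually_elim
  case (elim y)
  have "\<bar>\<xi> \<bullet> y\<bar> \<le> norm \<xi> * R"
    by (rule order.trans[OF Cauchy_Schwarz_ineq2]) (intro mult_left_mono elim norm_ge_zero)
  moreover have "\<bar>\<beta> * (norm y)\<^sup>2\<bar> \<le> \<bar>\<beta>\<bar> * R\<^sup>2"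
    unfolding abs_mult using elim by (intro mult_mono) (auto intro!: power_mono)
  ultimately show ?case by (simp add: mult.commute)
qed

lemma integrable_tilt_weight: "integrable \<nu> (tilt_weight \<xi> \<beta>)"
  using integrable_scaleR_exp[of "\<lambda>_. 1::real" _ 1, OF _ _ _ exponent_bound[of \<xi> \<beta>]]
  by (simp add: tilt_weight_def[abs_def])

lemma tilt_weight_integral_pos: "0 < (\<integral>y. tilt_weight \<xi> \<beta> y \<partial>\<nu>)"
proof -
  have "(\<integral>y. tilt_weight \<xi> \<beta> y \<partial>\<nu>) \<noteq> 0"
    using integral_nonneg_eq_0_iff_AE[OF integrable_tilt_weight[of \<xi> \<beta>]] tilt_weight_pos[of \<xi> \<beta>]
    by (simp add: less_imp_le less_imp_neq[THEN not_sym])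
  moreover have "0 \<le> (\<integral>y. tilt_weight \<xi> \<beta> y \<partial>\<nu>)" by (rule integral_nonneg_AE) (simp add: tilt_weight_def)
  ultimately show ?thesis by linarith
qed

definition tilt :: "'a \<Rightarrow> real \<Rightarrow> 'a measure" where
  "tilt \<xi> \<beta> = density \<nu> (\<lambda>y. ennreal (tilt_weight \<xi> \<beta> y / (\<integral>y. tilt_weight \<xi> \<beta> y \<partial>\<nu>)))"

lemma sets_tilt [measurable_cong]: "sets (tilt \<xi> \<beta>) = sets borel"
  by (simp add: tilt_def sets_eq)

lemma integral_tilt:
  fixes f :: "'a \<Rightarrow> 'b::{banach, second_countable_topology}"
  assumes [measurable]: "f \<in> borel_measurable borel"
  shows "(\<integral>y. f y \<partial>tilt \<xi> \<beta>) = (\<integral>y. tilt_weight \<xi> \<beta> y *\<^sub>R f y \<partial>\<nu>) /\<^sub>R (\<integral>y. tilt_weight \<xi> \<beta> y \<partial>\<nu>)"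
proof -
  have "(\<integral>y. f y \<partial>tilt \<xi> \<beta>) = (\<integral>y. (tilt_weight \<xi> \<beta> y / (\<integral>y. tilt_weight \<xi> \<beta> y \<partial>\<nu>)) *\<^sub>R f y \<partial>\<nu>)"
    unfolding tilt_def using tilt_weight_integral_pos[of \<xi> \<beta>]
    by (intro integral_density) (auto simp: tilt_weight_def)
  also have "\<dots> = (\<integral>y. inverse (\<integral>y. tilt_weight \<xi> \<beta> y \<partial>\<nu>) *\<^sub>R (tilt_weight \<xi> \<beta> y *\<^sub>R f y) \<partial>\<nu>)"
    by (simp add: divide_inverse mult.commute)
  finally show ?thesis by (simp only: integral_scaleR_right)
qed

lemma bounded_prob_tilt: "bounded_prob (tilt \<xi> \<beta>) R"
proof (intro bounded_prob.intro prob_spaceI bounded_prob_axioms.intro)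
  have "emeasure (tilt \<xi> \<beta>) (space (tilt \<xi> \<beta>)) 
      = (\<integral>\<^sup>+y. ennreal (tilt_weight \<xi> \<beta> y / (\<integral>y. tilt_weight \<xi> \<beta> y \<partial>\<nu>)) \<partial>\<nu>)"
    unfolding tilt_def by (subst emeasure_density) (auto intro!: nn_integral_cong)
  also have "\<dots> = ennreal (\<integral>y. tilt_weight \<xi> \<beta> y / (\<integral>y. tilt_weight \<xi> \<beta> y \<partial>\<nu>) \<partial>\<nu>)"
    using tilt_weight_integral_pos[of \<xi> \<beta>] integrable_tilt_weight[of \<xi> \<beta>]
    by (intro nn_integral_eq_integral) (auto simp: tilt_weight_pos less_imp_le)
  finally show "emeasure (tilt \<xi> \<beta>) (space (tilt \<xi> \<beta>)) = 1"
    using tilt_weight_integral_pos[of \<xi> \<beta>] by simp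
  show "AE y in tilt \<xi> \<beta>. norm y \<le> R"
    unfolding tilt_def using bounded by (subst AE_density) auto
qed (simp add: sets_tilt)

lemma tilt_mean_eq: "tilt_mean \<nu> \<xi> \<beta> = (\<integral>y. y \<partial>tilt \<xi> \<beta>)"
  by (simp add: tilt_mean_def integral_tilt)

text \<open>Weights multiply, so a tilt can be split at any base point. Estimates near
  \<open>(\<xi>, \<beta>)\<close> become estimates near zero for the measure
  \<open>tilt \<xi> \<beta>\<close>, which satisfies the same bound \<open>R\<close>.\<close>

lemma tilt_mean_add:
  "tilt_mean \<nu> (\<xi> + \<eta>) (\<beta> + \<rho>) = tilt_mean (tilt \<xi> \<beta>) \<eta> \<rho>"
  unfolding tilt_mean_def using tilt_weight_integral_pos[of \<xi> \<beta>]
  by (simp add: integral_tilt tilt_weight_add[abs_def] inverse_eq_divide)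

text \<open>The first bound of \<open>exp_tilt\<close>, for the tilted measure and the increment of
  the exponent. Both parameters of the posterior depend on time, so this joint estimate is what
  makes the field continuous in \<open>t\<close>.\<close>

lemma tilt_mean_lipschitz:
  "norm (tilt_mean \<nu> \<xi>' \<beta>' - tilt_mean \<nu> \<xi> \<beta>) \<le> 12 * R * (R * norm (\<xi>' - \<xi>) + R\<^sup>2 * \<bar>\<beta>' - \<beta>\<bar>)"
proof -
  interpret P: bounded_prob "tilt \<xi> \<beta>" R by (rule bounded_prob_tilt)
  show ?thesis
    using P.exp_tilt(1)[of "\<lambda>y. y", OF _ _ P.bounded P.exponent_bound[of "\<xi>' - \<xi>" "\<beta>' - \<beta>"]]
      tilt_mean_add[of \<xi> "\<xi>' - \<xi>" \<beta> "\<beta>' - \<beta>"]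
    by (simp add: tilt_mean_eq[of \<xi> \<beta>] tilt_mean_def[of "tilt \<xi> \<beta>"] tilt_weight_def)
qed

text \<open>The derivative in direction \<open>h\<close> is the covariance of
  \<open>h \<bullet> y\<close> and \<open>y\<close> under the tilted law. The covariance is at most
  \<open>2 * R\<^sup>2 * norm h\<close>; the larger factor 12 is forced by the Lipschitz bound
  inherited from \<open>exp_tilt\<close>.\<close>

lemma C11_tilt_mean: "C11 (12 * R\<^sup>2) (18 * R ^ 3) (\<lambda>\<xi>. tilt_mean \<nu> \<xi> \<beta>)"
proof (rule C11I[of "\<lambda>\<xi> h. (\<integral>y. (h \<bullet> y) *\<^sub>R y \<partial>tilt \<xi> \<beta>) - (\<integral>y. h \<bullet> y \<partial>tilt \<xi> \<beta>) *\<^sub>R (\<integral>y. y \<partial>tilt \<xi> \<beta>)"])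
  fix \<xi> \<xi>' h
  interpret P: bounded_prob "tilt \<xi> \<beta>" R by (rule bounded_prob_tilt)
  have b1: "AE y in tilt \<xi> \<beta>. norm (h \<bullet> y) \<le> R * norm h" for h
    using P.exponent_bound[of h 0] by simp
  have b2: "AE y in tilt \<xi> \<beta>. norm ((h \<bullet> y) *\<^sub>R y) \<le> R\<^sup>2 * norm h" for h
    using b1[of h] P.bounded
  proof eventually_elim
    case (elim y)
    then have "\<bar>h \<bullet> y\<bar> * norm y \<le> (R * norm h) * R" using R_nonneg by (intro mult_mono) auto
    then show ?case by (simp add: power2_eq_square mult_ac)
  qed
  have i0: "integrable (tilt \<xi> \<beta>) (\<lambda>y. y)" by (rule P.integrable_const_bound[OF P.bounded]) simp
  have i1: "integrable (tilt \<xi> \<beta>) (\<lambda>y. h \<bullet> y)" for h by (rule P.integrable_const_bound[OF b1]) simp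
  have i2: "integrable (tilt \<xi> \<beta>) (\<lambda>y. (h \<bullet> y) *\<^sub>R y)" for h
    by (rule P.integrable_const_bound[OF b2]) simp
  have bnd: "norm (\<integral>y. f y \<partial>tilt \<xi> \<beta>) \<le> B" if "AE y in tilt \<xi> \<beta>. norm (f y) \<le> B"
    "integrable (tilt \<xi> \<beta>) f"
    for f :: "'a \<Rightarrow> 'c::{banach, second_countable_topology}" and B
  proof -
    have "norm (\<integral>y. f y \<partial>tilt \<xi> \<beta>) \<le> (\<integral>y. norm (f y) \<partial>tilt \<xi> \<beta>)"
      by (rule integral_norm_bound)
    also have "\<dots> \<le> (\<integral>y. B \<partial>tilt \<xi> \<beta>)" using that by (intro integral_mono_AE) auto
    finally show ?thesis by (simp add: P.prob_space)
  qed
  let ?D = "\<lambda>h. (\<integral>y. (h \<bullet> y) *\<^sub>R y \<partial>tilt \<xi> \<beta>) - (\<integral>y. h \<bullet> y \<partial>tilt \<xi> \<beta>) *\<^sub>R (\<integral>y. y \<partial>tilt \<xi> \<beta>)"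
  show "linear ?D"
    by (rule linearI) (use i0 i1 i2 in \<open>simp_all add: inner_add_left scaleR_add_left scaleR_diff_right flip: scaleR_scaleR\<close>)
  have "norm (?D h) \<le> R\<^sup>2 * norm h + (R * norm h) * R"
    unfolding norm_scaleR
    by (intro order.trans[OF norm_triangle_ineq4] add_mono bnd[OF b2 i2])
      (simp, intro mult_mono bnd[OF P.bounded i0] bnd[OF b1 i1, unfolded real_norm_def]; use R_nonneg in simp)
  also have "\<dots> = 2 * R\<^sup>2 * norm h" by (simp add: power2_eq_square)
  also have "\<dots> \<le> 12 * R\<^sup>2 * norm h" by (intro mult_right_mono) auto
  finally show "norm (?D h) \<le> 12 * R\<^sup>2 * norm h" .
  show "norm (tilt_mean \<nu> \<xi>' \<beta> - tilt_mean \<nu> \<xi> \<beta>) \<le> 12 * R\<^sup>2 * norm (\<xi>' - \<xi>)"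
    using tilt_mean_lipschitz[of \<xi>' \<beta> \<xi> \<beta>] by (simp add: power2_eq_square mult.assoc)
  show "norm (tilt_mean \<nu> \<xi>' \<beta> - tilt_mean \<nu> \<xi> \<beta> - ?D (\<xi>' - \<xi>)) \<le> 18 * R ^ 3 * (norm (\<xi>' - \<xi>))\<^sup>2"
    using P.exp_tilt(2)[of "\<lambda>y. y", OF _ _ P.bounded b1[of "\<xi>' - \<xi>", unfolded real_norm_def]]
      tilt_mean_add[of \<xi> "\<xi>' - \<xi>" \<beta> 0]
    by (simp add: tilt_mean_eq[of \<xi> \<beta>] tilt_mean_def[of "tilt \<xi> \<beta>"] tilt_weight_def
        power2_eq_square power3_eq_cube mult_ac)
qed

end

section \<open>Initial value problems with a Lipschitz field\<close>

text \<open>Uniform continuity of the derivative on the compact interval makes the remainder small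
  uniformly in the base point. This serves the solution curves in the Euler estimate and the
  coefficients \<open>a\<close>, \<open>b\<close> in the weak estimate.\<close>

lemma uniform_linearization:
  fixes y :: "real \<Rightarrow> 'a::real_normed_vector"
  assumes y: "\<And>t. t \<in> {0..T} \<Longrightarrow> (y has_vector_derivative y' t) (at t within {0..T})"
    and y': "continuous_on {0..T} y'" and "0 < e"
  obtains d where "0 < d" "\<And>s t. s \<in> {0..T} \<Longrightarrow> t \<in> {0..T} \<Longrightarrow> \<bar>s - t\<bar> < d \<Longrightarrow>
    norm (y s - y t - (s - t) *\<^sub>R y' t) \<le> e * \<bar>s - t\<bar>"
proof -
  have "uniformly_continuous_on {0..T} y'" using y' by (intro compact_uniformly_continuous) auto
  then obtain d where d: "0 < d"
    "\<And>s t. s \<in> {0..T} \<Longrightarrow> t \<in> {0..T} \<Longrightarrow> dist s t < d \<Longrightarrow> dist (y' s) (y' t) < e"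
    using \<open>0 < e\<close> unfolding uniformly_continuous_on_def by metis
  show ?thesis
  proof (rule that[OF \<open>0 < d\<close>])
    fix s t assume st: "s \<in> {0..T}" "t \<in> {0..T}" "\<bar>s - t\<bar> < d"
    have sub: "closed_segment t s \<subseteq> {0..T}"
      using st by (auto simp: closed_segment_eq_real_ivl split: if_splits)
    have "norm (y s - y t - (s - t) *\<^sub>R y' t) \<le> norm (s - t) * e"
    proof (rule vector_differentiable_bound_linearization[where S = "closed_segment t s"])
      fix u assume "u \<in> closed_segment t s"
      then show "(y has_vector_derivative y' u) (at u within closed_segment t s)"
        using y sub by (blast intro: has_vector_derivative_within_subset)
    next
      fix u assume u: "u \<in> closed_segment t s"
      have "dist u t < d" using segment_bound1[OF u] st by (simp add: dist_real_def)
      then show "norm (y' u - y' t) \<le> e"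
        using d(2)[of u t] u sub st by (auto simp: dist_norm)
    qed auto
    then show "norm (y s - y t - (s - t) *\<^sub>R y' t) \<le> e * \<bar>s - t\<bar>" by (simp add: mult.commute)
  qed
qed

lemma ivp_solution_continuous_on: "ivp_solution v T x y \<Longrightarrow> continuous_on {0..T} y"
  unfolding ivp_solution_def by (auto intro: continuous_on_vector_derivative)

text \<open>The last step is the outermost map, so an induction on \<open>j\<close> can compose it
  with a test function.\<close>

primrec euler :: "(real \<Rightarrow> 'a::real_vector \<Rightarrow> 'a) \<Rightarrow> real \<Rightarrow> nat \<Rightarrow> 'a \<Rightarrow> 'a" where
  "euler v h 0 x = x"
| "euler v h (Suc j) x = euler v h j x + h *\<^sub>R v (real j * h) (euler v h j x)"

text \<open>In the Picard estimate, integrating the exponential weight produces the factor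
  \<open>1 / k\<close> that beats the Lipschitz constant.\<close>

lemma integral_exp_le:
  fixes k \<tau> :: real
  assumes "0 < k" "0 \<le> \<tau>"
  shows "(\<lambda>s. exp (k * s)) integrable_on {0..\<tau>}" "integral {0..\<tau>} (\<lambda>s. exp (k * s)) \<le> exp (k * \<tau>) / k"
proof -
  have "((\<lambda>s. exp (k * s)) has_integral (exp (k * \<tau>) / k - exp (k * 0) / k)) {0..\<tau>}"
    using assms by (intro fundamental_theorem_of_calculus[where f = "\<lambda>s. exp (k * s) / k"])
      (auto intro!: derivative_eq_intros simp flip: has_real_derivative_iff_has_vector_derivative)
  then show "(\<lambda>s. exp (k * s)) integrable_on {0..\<tau>}"
    "integral {0..\<tau>} (\<lambda>s. exp (k * s)) \<le> exp (k * \<tau>) / k"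
    using assms by (auto simp: integral_unique integrable_on_def)
qed

section \<open>Stability, existence and Euler approximation of solutions\<close>

locale lipschitz_ivp =
  fixes v :: "real \<Rightarrow> 'a::euclidean_space \<Rightarrow> 'a" and T L :: real
  assumes L_nonneg: "0 \<le> L" and T_nonneg: "0 \<le> T"
    and lip: "\<And>t x y. t \<in> {0..T} \<Longrightarrow> norm (v t x - v t y) \<le> L * norm (x - y)"
    and cont: "continuous_on ({0..T} \<times> UNIV) (\<lambda>(t, x). v t x)"
begin

lemma continuous_on_along: "continuous_on {0..T} y \<Longrightarrow> continuous_on {0..T} (\<lambda>s. v s (y s))"
  using continuous_on_compose2[OF cont, of "{0..T}" "\<lambda>s. (s, y s)"]
  by (simp add: continuous_on_Pair continuous_on_id image_subset_iff)

text \<open>Gronwall's argument: the squared distance, damped by \<open>exp (- 2 * L * s)\<close>,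
  is nonincreasing. The square is differentiable even where the curves meet. Besides uniqueness, the
  bound gives Lipschitz dependence on the initial value, hence measurability of the flow.\<close>

lemma solutions_close:
  assumes "ivp_solution v T x y" "ivp_solution v T x' y'" "t \<in> {0..T}"
  shows "norm (y t - y' t) \<le> exp (L * t) * norm (x - x')"
proof -
  define \<phi> where "\<phi> s = exp (- 2 * L * s) * ((y s - y' s) \<bullet> (y s - y' s))" for s
  have "\<phi> t \<le> \<phi> 0"
  proof (rule DERIV_nonpos_imp_decreasing_open[where f = \<phi> and a = 0 and b = t])
    show "0 \<le> t" using assms by simp
    have "continuous_on {0..t} y" "continuous_on {0..t} y'"
      using assms(3) ivp_solution_continuous_on[OF assms(1)] ivp_solution_continuous_on[OF assms(2)]
      by (auto elim: continuous_on_subset)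
    then show "continuous_on {0..t} \<phi>" unfolding \<phi>_def by (intro continuous_intros)
    fix s assume s: "0 < s" "s < t"
    then have at: "at s within {0..T} = at s" using assms(3) by (intro at_within_interior) auto
    then have d: "(y has_vector_derivative v s (y s)) (at s)" "(y' has_vector_derivative v s (y' s)) (at s)"
      using assms s unfolding ivp_solution_def by (simp_all flip: at)
    let ?d = "y s - y' s" and ?d' = "v s (y s) - v s (y' s)"
    have "((\<lambda>s. (y s - y' s) \<bullet> (y s - y' s)) has_vector_derivative (?d \<bullet> ?d' + ?d' \<bullet> ?d)) (at s)"
      using d by (intro bounded_bilinear.has_vector_derivative[OF bounded_bilinear_inner]
          has_vector_derivative_diff)
    then have "((\<lambda>s. (y s - y' s) \<bullet> (y s - y' s)) has_real_derivative (?d \<bullet> ?d' + ?d' \<bullet> ?d)) (at s)"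
      by (simp add: has_real_derivative_iff_has_vector_derivative)
    then have "(\<phi> has_real_derivative
        exp (- 2 * L * s) * (?d \<bullet> ?d' + ?d' \<bullet> ?d) + exp (- 2 * L * s) * (- 2 * L) * (?d \<bullet> ?d)) (at s)"
      unfolding \<phi>_def by (auto intro!: derivative_eq_intros)
    moreover have "?d \<bullet> ?d' \<le> L * (?d \<bullet> ?d)"
    proof -
      have "?d \<bullet> ?d' \<le> norm ?d * norm ?d'" by (rule norm_cauchy_schwarz)
      also have "\<dots> \<le> norm ?d * (L * norm ?d)" using lip assms(3) s by (intro mult_left_mono) auto
      finally show ?thesis by (simp add: power2_norm_eq_inner[symmetric] power2_eq_square mult_ac)
    qed
    then have "exp (- 2 * L * s) * (?d \<bullet> ?d' + ?d' \<bullet> ?d - 2 * L * (?d \<bullet> ?d)) \<le> 0"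
      by (intro mult_nonneg_nonpos) (auto simp: inner_commute)
    ultimately show "\<exists>m. (\<phi> has_real_derivative m) (at s) \<and> m \<le> 0"
      by (intro exI conjI) (assumption, simp add: algebra_simps)
  qed
  have "(norm (y t - y' t))\<^sup>2 = (exp (L * t))\<^sup>2 * \<phi> t"
    by (simp add: \<phi>_def power2_norm_eq_inner flip: exp_of_nat_mult exp_add mult.assoc)
  also have "\<dots> \<le> (exp (L * t))\<^sup>2 * \<phi> 0" using \<open>\<phi> t \<le> \<phi> 0\<close> by (intro mult_left_mono) auto
  also have "\<phi> 0 = (norm (x - x'))\<^sup>2"
    using assms by (simp add: \<phi>_def ivp_solution_def power2_norm_eq_inner)
  finally have "(norm (y t - y' t))\<^sup>2 \<le> (exp (L * t) * norm (x - x'))\<^sup>2"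
    by (simp only: power_mult_distrib)
  then show ?thesis by (rule power2_le_imp_le) simp
qed

lemma solution_unique:
  assumes "ivp_solution v T x y" "ivp_solution v T x y'" "t \<in> {0..T}"
  shows "y t = y' t"
  using solutions_close[OF assms] by simp

text \<open>The Picard operator acts on \<open>z s = exp (- k * s) *\<^sub>R y s\<close>; with the weight \<open>k = 2 * L + 1\<close> it is a
  contraction on the whole interval at once.\<close>

lemma solution_exists: "\<exists>y. ivp_solution v T x y"
proof -
  \<comment> \<open>The summand 1 keeps \<open>k\<close> positive when \<open>L = 0\<close>; the
    contraction factor is \<open>L / k \<le> 1 / 2\<close>.\<close>
  define k where "k = 2 * L + 1"
  have k: "0 < k" using L_nonneg by (simp add: k_def)
  \<comment> \<open>Bounded continuous functions live on the whole real line here, so the Picard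
    operator clamps time to \<open>{0..T}\<close>, where \<open>c\<close> is the identity.\<close>
  define c where "c t = max 0 (min T t)" for t
  have c: "c t \<in> {0..T}" "t \<in> {0..T} \<Longrightarrow> c t = t" for t using T_nonneg by (auto simp: c_def)
  define I where "I z \<tau> = integral {0..\<tau>} (\<lambda>s. v s (exp (k * s) *\<^sub>R apply_bcontfun z s))"
    for z :: "real \<Rightarrow>\<^sub>C 'a" and \<tau>
  have integrand: "continuous_on {0..T} (\<lambda>s. v s (exp (k * s) *\<^sub>R apply_bcontfun z s))" for z
    by (intro continuous_on_along continuous_intros) auto
  have int: "(\<lambda>s. v s (exp (k * s) *\<^sub>R apply_bcontfun z s)) integrable_on {0..\<tau>}"
    if "\<tau> \<in> {0..T}" for z \<tau>
    using that by (intro integrable_continuous_real continuous_on_subset[OF integrand]) auto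
  have I_deriv: "(I z has_vector_derivative v t (exp (k * t) *\<^sub>R apply_bcontfun z t)) (at t within {0..T})"
    if "t \<in> {0..T}" for z t
    unfolding I_def by (rule integral_has_vector_derivative[OF integrand that])
  have I_cont: "continuous_on {0..T} (I z)" for z
    using I_deriv by (rule continuous_on_vector_derivative)
  define P where "P z t = exp (- k * c t) *\<^sub>R (x + I z (c t))" for z t
  have P_bcont: "P z \<in> bcontfun" for z
  proof -
    have g: "continuous_on {0..T} (\<lambda>\<tau>. exp (- k * \<tau>) *\<^sub>R (x + I z \<tau>))"
      by (intro continuous_intros I_cont)
    have "continuous_on UNIV (P z)"
      unfolding P_def by (rule continuous_on_compose2[OF g])
        (use c in \<open>auto simp: c_def[abs_def] intro!: continuous_intros\<close>)
    moreover have "range (P z) \<subseteq> (\<lambda>\<tau>. exp (- k * \<tau>) *\<^sub>R (x + I z \<tau>)) ` {0..T}"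
      using c(1) by (auto simp: P_def)
    then have "bounded (range (P z))"
      by (rule bounded_subset[rotated]) (intro compact_imp_bounded compact_continuous_image g compact_Icc)
    ultimately show ?thesis by (simp add: bcontfun_def)
  qed
  have contract: "dist (Bcontfun (P z)) (Bcontfun (P w)) \<le> (1/2) * dist z w" for z w
  proof (rule dist_bound)
    fix t
    define \<tau> where "\<tau> = c t"
    have \<tau>: "\<tau> \<in> {0..T}" using c by (simp add: \<tau>_def)
    note ie = integral_exp_le[OF k, of \<tau>]
    have "norm (I z \<tau> - I w \<tau>) = norm (integral {0..\<tau>}
        (\<lambda>s. v s (exp (k * s) *\<^sub>R apply_bcontfun z s) - v s (exp (k * s) *\<^sub>R apply_bcontfun w s)))"
      unfolding I_def using int[OF \<tau>] by (subst integral_diff) auto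
    also have "\<dots> \<le> integral {0..\<tau>} (\<lambda>s. L * dist z w * exp (k * s))"
    proof (rule integral_norm_bound_integral)
      show "(\<lambda>s. v s (exp (k * s) *\<^sub>R apply_bcontfun z s) - v s (exp (k * s) *\<^sub>R apply_bcontfun w s))
          integrable_on {0..\<tau>}" using int[OF \<tau>] by (intro integrable_diff)
      show "(\<lambda>s. L * dist z w * exp (k * s)) integrable_on {0..\<tau>}"
        by (intro integrable_continuous_real continuous_intros)
      fix s assume "s \<in> {0..\<tau>}"
      then have "norm (v s (exp (k * s) *\<^sub>R apply_bcontfun z s) - v s (exp (k * s) *\<^sub>R apply_bcontfun w s))
          \<le> L * norm (exp (k * s) *\<^sub>R (apply_bcontfun z s - apply_bcontfun w s))"
        using lip \<tau> by (simp add: scaleR_diff_right)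
      also have "\<dots> \<le> L * (exp (k * s) * dist z w)"
        using L_nonneg dist_bounded[of z s w] by (auto intro!: mult_left_mono simp: dist_norm)
      finally show "norm (v s (exp (k * s) *\<^sub>R apply_bcontfun z s) - v s (exp (k * s) *\<^sub>R apply_bcontfun w s))
          \<le> L * dist z w * exp (k * s)" by (simp add: mult_ac)
    qed
    also have "\<dots> = L * dist z w * integral {0..\<tau>} (\<lambda>s. exp (k * s))"
      by (rule integral_mult_right)
    also have "\<dots> \<le> L * dist z w * (exp (k * \<tau>) / k)"
      using ie(2) \<tau> L_nonneg by (intro mult_left_mono) auto
    finally have "exp (- k * \<tau>) * norm (I z \<tau> - I w \<tau>) \<le> exp (- k * \<tau>) * (L * dist z w * (exp (k * \<tau>) / k))"
      by (intro mult_left_mono) auto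
    also have "\<dots> = (L / k) * dist z w" by (simp add: exp_minus field_simps)
    also have "\<dots> \<le> (1/2) * dist z w"
      using k L_nonneg by (intro mult_right_mono) (auto simp: k_def field_simps)
    finally have "norm (P z t - P w t) \<le> (1/2) * dist z w"
      by (simp add: P_def \<tau>_def[symmetric] flip: scaleR_diff_right)
    then show "dist (apply_bcontfun (Bcontfun (P z)) t) (apply_bcontfun (Bcontfun (P w)) t) \<le> (1/2) * dist z w"
      by (simp add: Bcontfun_inverse[OF P_bcont] dist_norm)
  qed
  have "\<exists>!z. Bcontfun (P z) = z"
    by (rule banach_fix_type[of "1/2"]) (simp, simp, intro allI contract)
  then obtain z where z: "Bcontfun (P z) = z" by blast
  have z': "apply_bcontfun z t = P z t" for t
    using arg_cong[OF z, of "\<lambda>f. apply_bcontfun f t"] Bcontfun_inverse[OF P_bcont[of z]] by simp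
  have fixpoint: "exp (k * t) *\<^sub>R apply_bcontfun z t = x + I z t" if "t \<in> {0..T}" for t
    unfolding z' P_def c(2)[OF that] by (simp flip: exp_add)
  have "ivp_solution v T x (\<lambda>t. x + I z t)"
    unfolding ivp_solution_def
  proof (intro conjI ballI)
    show "x + I z 0 = x" by (simp add: I_def)
    fix t assume t: "t \<in> {0..T}"
    show "((\<lambda>t. x + I z t) has_vector_derivative v t (x + I z t)) (at t within {0..T})"
      using has_vector_derivative_add[OF has_vector_derivative_const I_deriv[OF t, of z], of x]
      by (simp add: fixpoint[OF t])
  qed
  then show ?thesis by blast
qed

text \<open>Each step adds at most \<open>e * h\<close> and multiplies the earlier error by at most
  \<open>1 + h * L\<close>. Charging every local error the full power, instead of summing a
  geometric series, avoids a division by \<open>L\<close>.\<close>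

lemma euler_error:
  assumes y: "ivp_solution v T x y" and h: "0 \<le> h" "0 \<le> e"
    and lin: "\<And>s t. s \<in> {0..T} \<Longrightarrow> t \<in> {0..T} \<Longrightarrow> \<bar>s - t\<bar> < d \<Longrightarrow>
      norm (y s - y t - (s - t) *\<^sub>R v t (y t)) \<le> e * \<bar>s - t\<bar>"
    and "h < d" "real j * h \<le> T"
  shows "norm (y (real j * h) - euler v h j x) \<le> real j * h * e * (1 + h * L) ^ j"
  using \<open>real j * h \<le> T\<close>
proof (induction j)
  case 0
  then show ?case using y by (simp add: ivp_solution_def)
next
  case (Suc j)
  let ?t = "real j * h" and ?s = "real (Suc j) * h"
  have t: "?t \<in> {0..T}" "?s \<in> {0..T}" using Suc.prems h by (auto simp: algebra_simps)
  have st: "?s - ?t = h" by (simp add: algebra_simps)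
  have "1 \<le> (1 + h * L) ^ j" "1 \<le> 1 + h * L" "0 \<le> h * L" using h L_nonneg by (auto intro!: one_le_power)
  then have p: "1 \<le> (1 + h * L) ^ Suc j" by (intro one_le_power) auto
  have IH: "norm (y ?t - euler v h j x) \<le> real j * h * e * (1 + h * L) ^ j"
    using Suc t by auto
  have "y ?s - euler v h (Suc j) x = (y ?s - y ?t - (?s - ?t) *\<^sub>R v ?t (y ?t))
      + ((y ?t - euler v h j x) + h *\<^sub>R (v ?t (y ?t) - v ?t (euler v h j x)))"
    unfolding st by (simp add: scaleR_diff_right)
  also have "norm \<dots> \<le> e * h + (norm (y ?t - euler v h j x) + h * (L * norm (y ?t - euler v h j x)))"
  proof (intro norm_triangle_le add_mono order_refl)
    show "norm (y ?s - y ?t - (?s - ?t) *\<^sub>R v ?t (y ?t)) \<le> e * h"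
      using lin[OF t(2) t(1)] h \<open>h < d\<close> unfolding st by simp
  qed (use lip[OF t(1)] h in \<open>auto intro!: mult_left_mono\<close>)
  also have "\<dots> = e * h + (1 + h * L) * norm (y ?t - euler v h j x)" by (simp add: algebra_simps)
  also have "\<dots> \<le> e * h * (1 + h * L) ^ Suc j + (1 + h * L) * (real j * h * e * (1 + h * L) ^ j)"
    using mult_left_mono[OF p, of "e * h"] IH h \<open>0 \<le> h * L\<close> by (intro add_mono mult_left_mono) auto
  also have "\<dots> = real (Suc j) * h * e * (1 + h * L) ^ Suc j" by (simp add: algebra_simps)
  finally show ?case .
qed

lemma euler_tendsto:
  assumes y: "ivp_solution v T x y" and t: "t \<in> {0..T}"
  shows "(\<lambda>n. euler v (t / real n) n x) \<longlonglongrightarrow> y t"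
proof (rule tendstoI)
  fix e :: real assume "0 < e"
  \<comment> \<open>\<open>t + 1\<close> in place of \<open>t\<close> avoids a division by zero at
    \<open>t = 0\<close>.\<close>
  define e' where "e' = e / (2 * ((t + 1) * exp (t * L)))"
  have e': "0 < e'" using \<open>0 < e\<close> t by (simp add: e'_def)
  obtain d where d: "0 < d" "\<And>s t. s \<in> {0..T} \<Longrightarrow> t \<in> {0..T} \<Longrightarrow> \<bar>s - t\<bar> < d \<Longrightarrow>
      norm (y s - y t - (s - t) *\<^sub>R v t (y t)) \<le> e' * \<bar>s - t\<bar>"
    by (rule uniform_linearization[OF _ continuous_on_along[OF ivp_solution_continuous_on[OF y]] e'])
      (use y in \<open>auto simp: ivp_solution_def\<close>)
  have "(\<lambda>n. t / real n) \<longlonglongrightarrow> 0" by (rule lim_const_over_n)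
  then have "\<forall>\<^sub>F n in sequentially. t / real n < d" using d(1) by (rule order_tendstoD)
  then show "\<forall>\<^sub>F n in sequentially. dist (euler v (t / real n) n x) (y t) < e"
    using eventually_gt_at_top[of 0]
  proof eventually_elim
    case (elim n)
    let ?h = "t / real n"
    have h: "0 \<le> ?h" "real n * ?h = t" using t elim by auto
    have "norm (y t - euler v ?h n x) \<le> t * e' * (1 + ?h * L) ^ n"
      using euler_error[OF y h(1) less_imp_le[OF e'] d(2) elim(1), of n] h t by simp
    also have "\<dots> \<le> t * e' * exp (t * L)"
    proof -
      have "(1 + ?h * L) ^ n \<le> exp (?h * L) ^ n"
        using mult_nonneg_nonneg[OF h(1) L_nonneg] by (intro power_mono exp_ge_add_one_self) linarith
      also have "\<dots> = exp (real n * ?h * L)" by (simp flip: exp_of_nat_mult)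
      finally show ?thesis using t e' unfolding h(2) by (intro mult_left_mono) auto
    qed
    also have "\<dots> \<le> (t + 1) * e' * exp (t * L)" using e' by (intro mult_right_mono) auto
    also have "\<dots> = e / 2" using t by (simp add: e'_def)
    also have "\<dots> < e" using \<open>0 < e\<close> by simp
    finally show ?case by (simp add: dist_norm norm_minus_commute)
  qed
qed

end

section \<open>The joint law of the interpolant and its endpoint\<close>

lemma nn_integral_lborel_affine:
  fixes t :: "'a::euclidean_space"
  assumes [measurable]: "f \<in> borel_measurable borel" and "c \<noteq> 0"
  shows "(\<integral>\<^sup>+x. f x \<partial>lborel) = ennreal (\<bar>c\<bar> ^ DIM('a)) * (\<integral>\<^sup>+z. f (t + c *\<^sub>R z) \<partial>lborel)"
  by (subst lborel_affine[OF \<open>c \<noteq> 0\<close>, of t])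
    (simp add: nn_integral_density nn_integral_distr nn_integral_cmult)

lemma exp_quadratic_le: "x\<^sup>2 * exp (- x\<^sup>2 / 2) \<le> 4 * exp (- x\<^sup>2 / (4::real))"
proof -
  have "x\<^sup>2 / 4 \<le> exp (x\<^sup>2 / 4)" using exp_ge_add_one_self[of "x\<^sup>2 / 4"] by linarith
  then have "x\<^sup>2 / 4 * exp (- x\<^sup>2 / 2) \<le> exp (x\<^sup>2 / 4) * exp (- x\<^sup>2 / 2)"
    by (intro mult_right_mono) auto
  also have "\<dots> = exp (- x\<^sup>2 / 4)" by (simp flip: exp_add)
  finally show ?thesis by simp
qed

text \<open>By \<open>exp_quadratic_le\<close> the integrand is at most four times the Gaussian
  density stretched by \<open>sqrt 2\<close>, whose integral is finite by scaling. Normalization is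
  taken as a hypothesis because it comes for free from \<open>Z\<close> having this law.\<close>

lemma std_gaussian_second_moment:
  assumes "prob_space (std_gaussian :: 'a::euclidean_space measure)"
  shows "integrable (std_gaussian :: 'a measure) (\<lambda>z. (norm z)\<^sup>2)"
proof -
  define N where "N = sqrt (2 * pi) ^ DIM('a)"
  have N: "0 < N" by (simp add: N_def)
  define F where "F z = ennreal (exp (- (norm z)\<^sup>2 / 2) / N)" for z :: 'a
  have [measurable]: "F \<in> borel_measurable borel" unfolding F_def by measurable
  interpret prob_space "std_gaussian :: 'a measure" by fact
  have "(\<integral>\<^sup>+z. F z \<partial>lborel) = emeasure (std_gaussian :: 'a measure) (space std_gaussian)"
    unfolding std_gaussian_def by (simp add: emeasure_density F_def N_def)
  then have mass: "(\<integral>\<^sup>+z. F z \<partial>lborel) = 1" using emeasure_space_1 by simp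
  have "(\<integral>\<^sup>+z. ennreal ((norm z)\<^sup>2) \<partial>(std_gaussian :: 'a measure)) = (\<integral>\<^sup>+z. F z * ennreal ((norm z)\<^sup>2) \<partial>lborel)"
    unfolding std_gaussian_def F_def N_def by (subst nn_integral_density) auto
  also have "\<dots> \<le> (\<integral>\<^sup>+z. ennreal 4 * F ((1 / sqrt 2) *\<^sub>R z) \<partial>lborel)"
  proof (rule nn_integral_mono)
    fix z :: 'a
    have "F z * ennreal ((norm z)\<^sup>2) = ennreal ((norm z)\<^sup>2 * exp (- (norm z)\<^sup>2 / 2) / N)"
      unfolding F_def using N by (simp flip: ennreal_mult add: mult.commute)
    also have "\<dots> \<le> ennreal (4 * exp (- (norm z)\<^sup>2 / 4) / N)"
      using N exp_quadratic_le[of "norm z"] by (intro ennreal_leI divide_right_mono) auto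
    also have "\<dots> = ennreal 4 * F ((1 / sqrt 2) *\<^sub>R z)"
      unfolding F_def using N by (subst ennreal_mult[symmetric]) (auto simp: power_divide)
    finally show "F z * ennreal ((norm z)\<^sup>2) \<le> ennreal 4 * F ((1 / sqrt 2) *\<^sub>R z)" .
  qed
  also have "\<dots> = ennreal 4 * (\<integral>\<^sup>+z. F ((1 / sqrt 2) *\<^sub>R z) \<partial>lborel)"
    by (rule nn_integral_cmult) measurable
  also have "\<dots> < \<infinity>"
  proof -
    have "ennreal (\<bar>1 / sqrt 2\<bar> ^ DIM('a)) * (\<integral>\<^sup>+z. F (0 + (1 / sqrt 2) *\<^sub>R z) \<partial>lborel) = 1"
      by (subst nn_integral_lborel_affine[symmetric]) (auto simp: mass)
    then have "(\<integral>\<^sup>+z. F ((1 / sqrt 2) *\<^sub>R z) \<partial>lborel) \<noteq> \<infinity>"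
      by (auto simp: ennreal_mult_eq_top_iff)
    then show ?thesis by (simp add: ennreal_mult_less_top less_top)
  qed
  finally show ?thesis by (intro integrableI_bounded) (auto simp: std_gaussian_def)
qed

locale gaussian_interpolation = N: bounded_prob \<nu> R + M: prob_space M
  for \<nu> :: "'a::euclidean_space measure" and R :: real and M :: "'b measure" +
  fixes Z X1 :: "'b \<Rightarrow> 'a"
  assumes Z_law: "distr M borel Z = std_gaussian"
    and X1_law: "distr M borel X1 = \<nu>"
    and indep: "M.indep_var borel Z borel X1"
begin

lemma measurable_Z [measurable]: "Z \<in> borel_measurable M"
  and measurable_X1 [measurable]: "X1 \<in> borel_measurable M"
  using indep by (auto simp: M.indep_var_distribution_eq)

lemma X1_bounded: "AE \<omega> in M. norm (X1 \<omega>) \<le> R"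
  using N.bounded unfolding X1_law[symmetric] by (subst (asm) AE_distr_iff) auto

lemma integrable_X1: "integrable M X1"
  by (rule M.integrable_const_bound[OF X1_bounded]) simp

lemma integrable_Z_square: "integrable M (\<lambda>\<omega>. (norm (Z \<omega>))\<^sup>2)"
proof -
  have "prob_space (distr M borel Z)" by (rule M.prob_space_distr) simp
  then have "integrable (distr M borel Z) (\<lambda>z. (norm z)\<^sup>2)"
    unfolding Z_law by (rule std_gaussian_second_moment)
  then show ?thesis by (subst (asm) integrable_distr_eq) auto
qed

lemma integrable_Z: "integrable M Z"
proof (rule Bochner_Integration.integrable_bound)
  show "integrable M (\<lambda>\<omega>. 1 + (norm (Z \<omega>))\<^sup>2)" using integrable_Z_square by simp
  have "norm (Z \<omega>) \<le> 1 + (norm (Z \<omega>))\<^sup>2" for \<omega>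
    using zero_le_power2[of "norm (Z \<omega>) - 1", unfolded power2_diff one_power2 mult_1_right] zero_le_power2[of "norm (Z \<omega>)"]
      norm_ge_zero[of "Z \<omega>"] by linarith
  then show "AE \<omega> in M. norm (Z \<omega>) \<le> norm (1 + (norm (Z \<omega>))\<^sup>2)" by (intro AE_I2) (auto intro: order.trans)
qed simp

text \<open>The normal density at \<open>x\<close> with mean \<open>q *\<^sub>R y\<close> and
  covariance \<open>p\<^sup>2\<close> times the identity. The square in its exponent is expanded so
  that \<open>y\<close> enters only through a tilt weight.\<close>

definition joint_density :: "real \<Rightarrow> real \<Rightarrow> 'a \<Rightarrow> 'a \<Rightarrow> real" where
  "joint_density p q x y = exp (- (norm x)\<^sup>2 / (2 * p\<^sup>2)) / (sqrt (2 * pi) * \<bar>p\<bar>) ^ DIM('a) *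
     tilt_weight ((q / p\<^sup>2) *\<^sub>R x) (q\<^sup>2 / (2 * p\<^sup>2)) y"

lemma joint_density_pos: "p \<noteq> 0 \<Longrightarrow> 0 < joint_density p q x y"
  by (simp add: joint_density_def tilt_weight_def)

lemma joint_density_measurable [measurable]:
  "(\<lambda>(x, y). joint_density p q x y) \<in> borel_measurable (borel \<Otimes>\<^sub>M borel)"
  unfolding joint_density_def tilt_weight_def by measurable

lemma joint_density_affine:
  assumes "p \<noteq> 0"
  shows "\<bar>p\<bar> ^ DIM('a) * joint_density p q (q *\<^sub>R y + p *\<^sub>R z) y = exp (- (norm z)\<^sup>2 / 2) / sqrt (2 * pi) ^ DIM('a)"
proof -
  have "(norm (q *\<^sub>R y + p *\<^sub>R z))\<^sup>2 = q\<^sup>2 * (y \<bullet> y) + p\<^sup>2 * (z \<bullet> z) + 2 * (p * q * (y \<bullet> z))"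
    unfolding power2_norm_eq_inner
    by (simp add: inner_add_left inner_add_right inner_commute power2_eq_square)
  moreover have "((q / p\<^sup>2) *\<^sub>R (q *\<^sub>R y + p *\<^sub>R z)) \<bullet> y = q / p\<^sup>2 * (q * (y \<bullet> y) + p * (y \<bullet> z))"
    unfolding inner_scaleR_left inner_add_left inner_commute[of z y] ..
  moreover have "- (q\<^sup>2 * u + p\<^sup>2 * v + 2 * (p * q * w)) / (2 * p\<^sup>2) +
     (q / p\<^sup>2 * (q * u + p * w) - q\<^sup>2 / (2 * p\<^sup>2) * u) = - v / 2" for u v w
    using assms by (simp add: field_simps power2_eq_square)
  ultimately have "- (norm (q *\<^sub>R y + p *\<^sub>R z))\<^sup>2 / (2 * p\<^sup>2) +
     (((q / p\<^sup>2) *\<^sub>R (q *\<^sub>R y + p *\<^sub>R z)) \<bullet> y - q\<^sup>2 / (2 * p\<^sup>2) * (norm y)\<^sup>2) = - (norm z)\<^sup>2 / 2"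
    by (simp only: power2_norm_eq_inner)
  then show ?thesis
    using assms unfolding joint_density_def tilt_weight_def
    by (simp add: power_mult_distrib flip: exp_add)
qed

text \<open>By independence \<open>(Z, X1)\<close> has a product law. For fixed \<open>y\<close>,
  the substitution \<open>x = q *\<^sub>R y + p *\<^sub>R z\<close> turns the Gaussian integral over
  \<open>z\<close> into a Lebesgue integral over \<open>x\<close>; its Jacobian is the power of
  \<open>\<bar>p\<bar>\<close> in \<open>joint_density_affine\<close>.\<close>

lemma joint_law:
  assumes "p \<noteq> 0"
  shows "distr M (borel \<Otimes>\<^sub>M borel) (\<lambda>\<omega>. (p *\<^sub>R Z \<omega> + q *\<^sub>R X1 \<omega>, X1 \<omega>))
    = density (lborel \<Otimes>\<^sub>M \<nu>) (\<lambda>(x, y). ennreal (joint_density p q x y))"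
proof (rule measure_eqI)
  interpret L: pair_sigma_finite lborel \<nu> ..
  have "prob_space (distr M borel Z)" by (rule M.prob_space_distr) simp
  then interpret G: prob_space "std_gaussian :: 'a measure" unfolding Z_law .
  interpret GL: pair_sigma_finite "std_gaussian :: 'a measure" \<nu> ..
  have [measurable_cong]: "sets (std_gaussian :: 'a measure) = sets borel" by (simp add: std_gaussian_def)
  fix A assume "A \<in> sets (distr M (borel \<Otimes>\<^sub>M borel) (\<lambda>\<omega>. (p *\<^sub>R Z \<omega> + q *\<^sub>R X1 \<omega>, X1 \<omega>)))"
  then have A [measurable]: "A \<in> sets (borel \<Otimes>\<^sub>M borel)" by simp
  have sets_pair: "sets (lborel \<Otimes>\<^sub>M \<nu>) = sets (borel \<Otimes>\<^sub>M borel)"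
    by (intro sets_pair_measure_cong N.sets_eq sets_lborel)
  have law: "distr M (borel \<Otimes>\<^sub>M borel) (\<lambda>\<omega>. (Z \<omega>, X1 \<omega>)) = std_gaussian \<Otimes>\<^sub>M \<nu>"
    using indep by (simp add: M.indep_var_distribution_eq Z_law X1_law)
  have "emeasure (distr M (borel \<Otimes>\<^sub>M borel) (\<lambda>\<omega>. (p *\<^sub>R Z \<omega> + q *\<^sub>R X1 \<omega>, X1 \<omega>))) A
      = (\<integral>\<^sup>+\<omega>. indicator A (p *\<^sub>R Z \<omega> + q *\<^sub>R X1 \<omega>, X1 \<omega>) \<partial>M)"
    by (subst nn_integral_indicator[symmetric], simp, subst nn_integral_distr) auto
  also have "\<dots> = (\<integral>\<^sup>+u. indicator A (p *\<^sub>R fst u + q *\<^sub>R snd u, snd u) \<partial>distr M (borel \<Otimes>\<^sub>M borel) (\<lambda>\<omega>. (Z \<omega>, X1 \<omega>)))"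
    by (subst nn_integral_distr) auto
  also have "\<dots> = (\<integral>\<^sup>+y. \<integral>\<^sup>+z. indicator A (p *\<^sub>R z + q *\<^sub>R y, y) \<partial>std_gaussian \<partial>\<nu>)"
    unfolding law by (subst GL.nn_integral_snd[symmetric]) auto
  also have "\<dots> = (\<integral>\<^sup>+y. \<integral>\<^sup>+x. ennreal (joint_density p q x y) * indicator A (x, y) \<partial>lborel \<partial>\<nu>)"
  proof (rule nn_integral_cong)
    fix y
    have "(\<integral>\<^sup>+z. indicator A (p *\<^sub>R z + q *\<^sub>R y, y) \<partial>std_gaussian)
        = (\<integral>\<^sup>+z. ennreal (exp (- (norm z)\<^sup>2 / 2) / sqrt (2 * pi) ^ DIM('a)) * indicator A (p *\<^sub>R z + q *\<^sub>R y, y) \<partial>lborel)"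
      unfolding std_gaussian_def by (subst nn_integral_density) auto
    also have "\<dots> = (\<integral>\<^sup>+z. ennreal (\<bar>p\<bar> ^ DIM('a)) *
        (ennreal (joint_density p q (q *\<^sub>R y + p *\<^sub>R z) y) * indicator A (q *\<^sub>R y + p *\<^sub>R z, y)) \<partial>lborel)"
      unfolding joint_density_affine[OF assms, of q y, symmetric]
      using joint_density_pos[OF assms]
      by (intro nn_integral_cong) (simp add: ennreal_mult less_imp_le add.commute mult.assoc)
    also have "\<dots> = ennreal (\<bar>p\<bar> ^ DIM('a)) * (\<integral>\<^sup>+z.
        ennreal (joint_density p q (q *\<^sub>R y + p *\<^sub>R z) y) * indicator A (q *\<^sub>R y + p *\<^sub>R z, y) \<partial>lborel)"
      by (rule nn_integral_cmult) measurable
    also have "\<dots> = (\<integral>\<^sup>+x. ennreal (joint_density p q x y) * indicator A (x, y) \<partial>lborel)"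
      by (rule nn_integral_lborel_affine[OF _ assms, symmetric]) measurable
    finally show "(\<integral>\<^sup>+z. indicator A (p *\<^sub>R z + q *\<^sub>R y, y) \<partial>std_gaussian)
      = (\<integral>\<^sup>+x. ennreal (joint_density p q x y) * indicator A (x, y) \<partial>lborel)" .
  qed
  also have "\<dots> = (\<integral>\<^sup>+u. ennreal (joint_density p q (fst u) (snd u)) * indicator A u \<partial>(lborel \<Otimes>\<^sub>M \<nu>))"
    by (subst L.nn_integral_snd[symmetric]) (auto simp: measurable_split_conv)
  also have "\<dots> = emeasure (density (lborel \<Otimes>\<^sub>M \<nu>) (\<lambda>(x, y). ennreal (joint_density p q x y))) A"
    by (subst emeasure_density) (auto simp: sets_pair split_beta')
  finally show "emeasure (distr M (borel \<Otimes>\<^sub>M borel) (\<lambda>\<omega>. (p *\<^sub>R Z \<omega> + q *\<^sub>R X1 \<omega>, X1 \<omega>))) A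
      = emeasure (density (lborel \<Otimes>\<^sub>M \<nu>) (\<lambda>(x, y). ennreal (joint_density p q x y))) A" .
next
  show "sets (distr M (borel \<Otimes>\<^sub>M borel) (\<lambda>\<omega>. (p *\<^sub>R Z \<omega> + q *\<^sub>R X1 \<omega>, X1 \<omega>)))
    = sets (density (lborel \<Otimes>\<^sub>M \<nu>) (\<lambda>(x, y). ennreal (joint_density p q x y)))"
    by (simp add: N.sets_eq cong: sets_pair_measure_cong)
qed

text \<open>This makes the continuous version of a conditional expectation given the interpolant
  unique. The joint density is positive, so a set avoided almost surely is Lebesgue null, and a null
  open set is empty.\<close>

lemma open_charged:
  assumes "p \<noteq> 0" "open U" "AE \<omega> in M. p *\<^sub>R Z \<omega> + q *\<^sub>R X1 \<omega> \<notin> U"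
  shows "U = {}"
proof -
  interpret L: pair_sigma_finite lborel \<nu> ..
  have [measurable]: "U \<in> sets borel" using assms by simp
  have "AE u in distr M (borel \<Otimes>\<^sub>M borel) (\<lambda>\<omega>. (p *\<^sub>R Z \<omega> + q *\<^sub>R X1 \<omega>, X1 \<omega>)). fst u \<notin> U"
    using assms(3) by (subst AE_distr_iff) auto
  then have "AE u in lborel \<Otimes>\<^sub>M \<nu>. fst u \<notin> U"
    unfolding joint_law[OF assms(1)]
    by (subst (asm) AE_density) (auto simp: joint_density_pos[OF assms(1)] split_beta')
  then have "AE x in lborel. AE y in \<nu>. x \<notin> U"
    using L.AE_pair[of "\<lambda>u. fst u \<notin> U"] by simp
  then have "AE x in lborel. x \<notin> U" by (simp add: N.AE_const)
  then have "emeasure lborel U = 0"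
    by (subst (asm) AE_iff_measurable[OF _ refl]) auto
  then have "negligible U"
    by (auto simp: negligible_iff_null_sets null_sets_def intro: null_sets_completionI)
  then show ?thesis using open_not_negligible[OF assms(2)] by blast
qed

definition posterior_mean :: "real \<Rightarrow> real \<Rightarrow> 'a \<Rightarrow> 'a" where
  "posterior_mean p q x = tilt_mean \<nu> ((q / p\<^sup>2) *\<^sub>R x) (q\<^sup>2 / (2 * p\<^sup>2))"

lemma C11_posterior_mean: 
  "C11 (12 * R\<^sup>2 * \<bar>q / p\<^sup>2\<bar>) (18 * R ^ 3 * \<bar>q / p\<^sup>2\<bar>\<^sup>2) (posterior_mean p q)"
  using C11_compose[OF N.C11_tilt_mean[of "q\<^sup>2 / (2 * p\<^sup>2)"] C11_scaleR[OF C11_id, of "q / p\<^sup>2"]] N.R_nonneg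
  by (simp add: posterior_mean_def[abs_def])

lemma posterior_mean_continuous: "continuous_on S (posterior_mean p q)"
  by (rule C11_continuous_on[OF C11_posterior_mean])

lemma posterior_mean_measurable [measurable]: "posterior_mean p q \<in> borel_measurable borel"
  by (rule borel_measurable_continuous_onI[OF posterior_mean_continuous])

lemma posterior_mean_bounded: "norm (posterior_mean p q x) \<le> R"
proof -
  interpret P: bounded_prob "N.tilt \<xi> \<beta>" R for \<xi> \<beta> by (rule N.bounded_prob_tilt)
  have "norm (\<integral>y. y \<partial>N.tilt \<xi> \<beta>) \<le> R" for \<xi> \<beta>
  proof -
    have i: "integrable (N.tilt \<xi> \<beta>) (\<lambda>y. y)" by (rule P.integrable_const_bound[OF P.bounded]) simp
    have "norm (\<integral>y. y \<partial>N.tilt \<xi> \<beta>) \<le> (\<integral>y. norm y \<partial>N.tilt \<xi> \<beta>)" by simp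
    also have "\<dots> \<le> (\<integral>y. R \<partial>N.tilt \<xi> \<beta>)"
      using i P.bounded by (intro integral_mono_AE) auto
    finally show ?thesis by (simp add: P.prob_space)
  qed
  then show ?thesis by (simp add: posterior_mean_def N.tilt_mean_eq)
qed

text \<open>Bayes' rule: for fixed \<open>x\<close> the joint density is a multiple of a tilt weight
  in \<open>y\<close>, and the integral of \<open>y\<close> against it is its mass times the tilted
  mean. The weight \<open>\<psi>\<close> is arbitrary to serve two uses: indicators for the
  conditional expectation, derivatives of test functions for the weak error.\<close>

lemma conditional_mean:
  fixes \<psi> :: "'a \<Rightarrow> real" and p q :: real
  assumes p: "p \<noteq> 0" and [measurable]: "\<psi> \<in> borel_measurable borel" and B: "\<And>x. \<bar>\<psi> x\<bar> \<le> B"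
  defines "I \<equiv> (\<lambda>\<omega>. p *\<^sub>R Z \<omega> + q *\<^sub>R X1 \<omega>)"
  shows "integrable M (\<lambda>\<omega>. \<psi> (I \<omega>) *\<^sub>R X1 \<omega>)"
    and "integrable M (\<lambda>\<omega>. \<psi> (I \<omega>) *\<^sub>R posterior_mean p q (I \<omega>))"
    and "(\<integral>\<omega>. \<psi> (I \<omega>) *\<^sub>R X1 \<omega> \<partial>M) = (\<integral>\<omega>. \<psi> (I \<omega>) *\<^sub>R posterior_mean p q (I \<omega>) \<partial>M)"
proof -
  interpret L: pair_sigma_finite lborel \<nu> ..
  have [measurable]: "I \<in> borel_measurable M" unfolding I_def by measurable
  let ?P = "borel \<Otimes>\<^sub>M borel :: ('a \<times> 'a) measure"
  have sets_pair: "sets (lborel \<Otimes>\<^sub>M \<nu>) = sets ?P"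
    by (intro sets_pair_measure_cong N.sets_eq sets_lborel)
  have "0 \<le> B" using B[of 0] by linarith
  show i1: "integrable M (\<lambda>\<omega>. \<psi> (I \<omega>) *\<^sub>R X1 \<omega>)"
  proof (rule M.integrable_const_bound[where B = "B * R"])
    show "AE \<omega> in M. norm (\<psi> (I \<omega>) *\<^sub>R X1 \<omega>) \<le> B * R"
      using X1_bounded by eventually_elim (auto intro!: mult_mono B \<open>0 \<le> B\<close>)
  qed simp
  show i2: "integrable M (\<lambda>\<omega>. \<psi> (I \<omega>) *\<^sub>R posterior_mean p q (I \<omega>))"
    by (rule M.integrable_const_bound[where B = "B * R"])
      (auto intro!: mult_mono B \<open>0 \<le> B\<close> posterior_mean_bounded)
  \<comment> \<open>One Fubini computation for both sides: \<open>f\<close> is later instantiated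
    with \<open>snd\<close> and with the posterior mean of the first component.\<close>
  have transfer: "(\<integral>\<omega>. \<psi> (I \<omega>) *\<^sub>R f (I \<omega>, X1 \<omega>) \<partial>M)
      = (\<integral>x. \<integral>y. joint_density p q x y *\<^sub>R (\<psi> x *\<^sub>R f (x, y)) \<partial>\<nu> \<partial>lborel)"
    if [measurable]: "f \<in> borel_measurable ?P" and i: "integrable M (\<lambda>\<omega>. \<psi> (I \<omega>) *\<^sub>R f (I \<omega>, X1 \<omega>))"
    for f :: "'a \<times> 'a \<Rightarrow> 'a"
  proof -
    let ?f = "\<lambda>u. \<psi> (fst u) *\<^sub>R f u"
    have i': "integrable (density (lborel \<Otimes>\<^sub>M \<nu>) (\<lambda>(x, y). ennreal (joint_density p q x y))) ?f"
      unfolding joint_law[OF p, symmetric] using i by (subst integrable_distr_eq) (auto simp: I_def)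
    have d: "(\<lambda>(x, y). ennreal (joint_density p q x y)) = (\<lambda>u. ennreal (joint_density p q (fst u) (snd u)))"
      by auto
    have jm: "(\<lambda>u. joint_density p q (fst u) (snd u)) \<in> borel_measurable (lborel \<Otimes>\<^sub>M \<nu>)"
      using joint_density_measurable[of p q] measurable_cong_sets[OF sets_pair refl, of borel]
      by (simp add: split_beta')
    have fm: "?f \<in> borel_measurable (lborel \<Otimes>\<^sub>M \<nu>)"
      unfolding measurable_cong_sets[OF sets_pair refl] by measurable
    have "(\<integral>\<omega>. \<psi> (I \<omega>) *\<^sub>R f (I \<omega>, X1 \<omega>) \<partial>M)
        = (\<integral>u. ?f u \<partial>distr M ?P (\<lambda>\<omega>. (p *\<^sub>R Z \<omega> + q *\<^sub>R X1 \<omega>, X1 \<omega>)))"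
      by (subst integral_distr) (auto simp: I_def)
    also have "\<dots> = (\<integral>u. joint_density p q (fst u) (snd u) *\<^sub>R ?f u \<partial>(lborel \<Otimes>\<^sub>M \<nu>))"
      unfolding joint_law[OF p] d
      by (rule integral_density[OF fm jm]) (simp add: joint_density_pos[OF p] less_imp_le)
    also have "\<dots> = (\<integral>x. \<integral>y. joint_density p q x y *\<^sub>R (\<psi> x *\<^sub>R f (x, y)) \<partial>\<nu> \<partial>lborel)"
    proof -
      have "integrable (lborel \<Otimes>\<^sub>M \<nu>) (\<lambda>u. joint_density p q (fst u) (snd u) *\<^sub>R ?f u)"
        using i' unfolding d
        by (subst (asm) integrable_density[OF fm jm]) (simp_all add: joint_density_pos[OF p] less_imp_le)
      from L.integral_fst'[OF this] show ?thesis by simp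
    qed
    finally show ?thesis .
  qed
  have "(\<integral>y. joint_density p q x y *\<^sub>R (\<psi> x *\<^sub>R y) \<partial>\<nu>)
      = (\<integral>y. joint_density p q x y *\<^sub>R (\<psi> x *\<^sub>R posterior_mean p q x) \<partial>\<nu>)" for x
  proof -
    define \<xi> \<beta> k where "\<xi> = (q / p\<^sup>2) *\<^sub>R x" and "\<beta> = q\<^sup>2 / (2 * p\<^sup>2)"
      and "k = exp (- (norm x)\<^sup>2 / (2 * p\<^sup>2)) / (sqrt (2 * pi) * \<bar>p\<bar>) ^ DIM('a)"
    have j: "joint_density p q x y = k * tilt_weight \<xi> \<beta> y" for y
      by (simp add: joint_density_def \<xi>_def \<beta>_def k_def)
    have "(\<integral>y. joint_density p q x y *\<^sub>R (\<psi> x *\<^sub>R y) \<partial>\<nu>) = (\<integral>y. (k * \<psi> x) *\<^sub>R (tilt_weight \<xi> \<beta> y *\<^sub>R y) \<partial>\<nu>)"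
      by (simp add: j mult_ac)
    also have "\<dots> = (k * \<psi> x) *\<^sub>R (\<integral>y. tilt_weight \<xi> \<beta> y *\<^sub>R y \<partial>\<nu>)" by (rule integral_scaleR_right)
    also have "(\<integral>y. tilt_weight \<xi> \<beta> y *\<^sub>R y \<partial>\<nu>) = (\<integral>y. tilt_weight \<xi> \<beta> y \<partial>\<nu>) *\<^sub>R tilt_mean \<nu> \<xi> \<beta>"
      using N.tilt_weight_integral_pos[of \<xi> \<beta>] by (simp add: tilt_mean_def)
    also have "\<dots> = (\<integral>y. tilt_weight \<xi> \<beta> y *\<^sub>R tilt_mean \<nu> \<xi> \<beta> \<partial>\<nu>)"
      using N.integrable_tilt_weight by simp
    also have "(k * \<psi> x) *\<^sub>R \<dots> = (\<integral>y. (k * \<psi> x) *\<^sub>R (tilt_weight \<xi> \<beta> y *\<^sub>R tilt_mean \<nu> \<xi> \<beta>) \<partial>\<nu>)"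
      by (rule integral_scaleR_right[symmetric])
    finally show ?thesis by (simp add: j posterior_mean_def \<xi>_def \<beta>_def mult_ac)
  qed
  then show "(\<integral>\<omega>. \<psi> (I \<omega>) *\<^sub>R X1 \<omega> \<partial>M) = (\<integral>\<omega>. \<psi> (I \<omega>) *\<^sub>R posterior_mean p q (I \<omega>) \<partial>M)"
    using transfer[of snd] transfer[of "\<lambda>u. posterior_mean p q (fst u)"] i1 i2 by simp
qed

end

section \<open>The velocity field\<close>

text \<open>On a closed interval that stops before time 1, \<open>a\<close> is bounded away from
  zero, so all quotients by \<open>a\<close> are continuous and bounded. This is the source of every
  constant below.\<close>

locale smooth_interpolation = gaussian_interpolation \<nu> R M Z X1
  for \<nu> :: "'a::euclidean_space measure" and R M and Z X1 :: "'b \<Rightarrow> 'a" +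
  fixes a b a' b' :: "real \<Rightarrow> real" and T :: real
  assumes T_nonneg: "0 \<le> T"
    and a_pos: "\<And>t. t \<in> {0..T} \<Longrightarrow> 0 < a t"
    and a_deriv: "\<And>t. t \<in> {0..T} \<Longrightarrow> (a has_vector_derivative a' t) (at t within {0..T})"
    and b_deriv: "\<And>t. t \<in> {0..T} \<Longrightarrow> (b has_vector_derivative b' t) (at t within {0..T})"
    and a'_cont: "continuous_on {0..T} a'" and b'_cont: "continuous_on {0..T} b'"
begin

definition I :: "real \<Rightarrow> 'b \<Rightarrow> 'a" where
  "I t \<omega> = a t *\<^sub>R Z \<omega> + b t *\<^sub>R X1 \<omega>"

definition drift :: "real \<Rightarrow> real" where
  "drift t = b' t - a' t * b t / a t"

definition V :: "real \<Rightarrow> 'a \<Rightarrow> 'a" where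
  "V t x = (a' t / a t) *\<^sub>R x + drift t *\<^sub>R posterior_mean (a t) (b t) x"

lemma measurable_I [measurable]: "I t \<in> borel_measurable M"
  unfolding I_def[abs_def] by measurable

lemma a_cont: "continuous_on {0..T} a" and b_cont: "continuous_on {0..T} b"
  by (rule continuous_on_vector_derivative[OF a_deriv], assumption)
    (rule continuous_on_vector_derivative[OF b_deriv], assumption)

lemma a_nonzero: "t \<in> {0..T} \<Longrightarrow> a t \<noteq> 0"
  using a_pos[of t] by simp

lemma drift_cont: "continuous_on {0..T} drift"
  unfolding drift_def[abs_def]
  by (intro continuous_intros a'_cont b'_cont a_cont b_cont) (simp add: a_nonzero)

lemma bounded_coefficient:
  fixes c :: "real \<Rightarrow> real"
  assumes "continuous_on {0..T} c"
  obtains K where "0 \<le> K" "\<And>t. t \<in> {0..T} \<Longrightarrow> \<bar>c t\<bar> \<le> K"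
proof -
  have "bounded (c ` {0..T})"
    by (intro compact_imp_bounded compact_continuous_image assms compact_Icc)
  then obtain K where "0 < K" "\<forall>y\<in>c ` {0..T}. norm y \<le> K" unfolding bounded_pos by blast
  then show ?thesis by (intro that[of K]) auto
qed

text \<open>One constant serves both bounds of \<open>C11\<close> and all times. The inner scaling
  by \<open>b t / (a t)\<^sup>2\<close> enters the Lipschitz constant linearly and the remainder
  quadratically.\<close>

lemma C11_V: obtains A where "0 \<le> A" "\<And>t. t \<in> {0..T} \<Longrightarrow> C11 A A (V t)"
proof -
  have c: "continuous_on {0..T} (\<lambda>t. a' t / a t)" "continuous_on {0..T} (\<lambda>t. b t / (a t)\<^sup>2)"
    by (intro continuous_intros a'_cont a_cont b_cont; simp add: a_nonzero)+
  obtain K1 where K1: "0 \<le> K1" "\<And>t. t \<in> {0..T} \<Longrightarrow> \<bar>a' t / a t\<bar> \<le> K1"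
    by (rule bounded_coefficient[OF c(1)]) blast
  obtain K2 where K2: "0 \<le> K2" "\<And>t. t \<in> {0..T} \<Longrightarrow> \<bar>drift t\<bar> \<le> K2"
    by (rule bounded_coefficient[OF drift_cont]) blast
  obtain K3 where K3: "0 \<le> K3" "\<And>t. t \<in> {0..T} \<Longrightarrow> \<bar>b t / (a t)\<^sup>2\<bar> \<le> K3"
    by (rule bounded_coefficient[OF c(2)]) blast
  define A1 where "A1 = K1 + K2 * (12 * R\<^sup>2 * K3)"
  define A2 where "A2 = K2 * (18 * R ^ 3 * K3\<^sup>2)"
  have nonneg: "0 \<le> A1" "0 \<le> A2" using K1 K2 K3 N.R_nonneg by (simp_all add: A1_def A2_def)
  show ?thesis
  proof (rule that[of "A1 + A2"])
    show "0 \<le> A1 + A2" using nonneg by simp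
    fix t assume t: "t \<in> {0..T}"
    have "C11 (\<bar>a' t / a t\<bar> * 1 + \<bar>drift t\<bar> * (12 * R\<^sup>2 * \<bar>b t / (a t)\<^sup>2\<bar>))
        (\<bar>a' t / a t\<bar> * 0 + \<bar>drift t\<bar> * (18 * R ^ 3 * \<bar>b t / (a t)\<^sup>2\<bar>\<^sup>2)) (V t)"
      unfolding V_def by (intro C11_add C11_scaleR C11_id C11_posterior_mean)
    moreover have "\<bar>a' t / a t\<bar> * 1 + \<bar>drift t\<bar> * (12 * R\<^sup>2 * \<bar>b t / (a t)\<^sup>2\<bar>) \<le> A1"
      unfolding A1_def
      by (intro add_mono mult_mono mult_left_mono) (use K1 K2 K3 t in \<open>auto simp del: abs_divide\<close>)
    moreover have "\<bar>a' t / a t\<bar> * 0 + \<bar>drift t\<bar> * (18 * R ^ 3 * \<bar>b t / (a t)\<^sup>2\<bar>\<^sup>2) \<le> A2"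
      unfolding A2_def mult_zero_right add_0
      by (intro mult_mono mult_left_mono power_mono)
        (use K2 K3 t N.R_nonneg in \<open>auto simp del: abs_divide\<close>)
    ultimately show "C11 (A1 + A2) (A1 + A2) (V t)" using nonneg by (elim C11_mono) auto
  qed
qed

text \<open>The joint Lipschitz bound for \<open>tilt_mean\<close> is composed with its two
  parameters, which are continuous in time and position.\<close>

lemma V_cont: "continuous_on ({0..T} \<times> UNIV) (\<lambda>(t, x). V t x)"
proof -
  define K where "K = 12 * R * (R + R\<^sup>2)"
  have "0 \<le> K" using N.R_nonneg by (simp add: K_def)
  have "continuous_on UNIV (\<lambda>u. tilt_mean \<nu> (fst u) (snd u))"
  proof (rule lipschitz_on_continuous_on[OF lipschitz_onI])
    fix u w :: "'a \<times> real"
    have "norm (tilt_mean \<nu> (fst u) (snd u) - tilt_mean \<nu> (fst w) (snd w))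
        \<le> 12 * R * (R * norm (fst u - fst w) + R\<^sup>2 * \<bar>snd u - snd w\<bar>)"
      by (rule N.tilt_mean_lipschitz)
    also have "\<dots> \<le> 12 * R * (R * dist u w + R\<^sup>2 * dist u w)"
      using dist_fst_le[of u w] dist_snd_le[of u w] N.R_nonneg
      by (intro mult_left_mono add_mono) (auto simp: dist_norm)
    also have "\<dots> = K * dist u w" by (simp add: K_def algebra_simps)
    finally show "dist (tilt_mean \<nu> (fst u) (snd u)) (tilt_mean \<nu> (fst w) (snd w)) \<le> K * dist u w"
      by (simp add: dist_norm)
  qed fact
  then have m: "continuous_on ({0..T} \<times> UNIV) (\<lambda>u. tilt_mean \<nu> (f u) (g u))"
    if "continuous_on ({0..T} \<times> UNIV) f" "continuous_on ({0..T} \<times> UNIV) g"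
    for f :: "real \<times> 'a \<Rightarrow> 'a" and g
    using continuous_on_compose2[OF _ continuous_on_Pair[OF that]] by fastforce
  have comp: "continuous_on ({0..T} \<times> UNIV) (\<lambda>u. c (fst u))" if "continuous_on {0..T} c"
    for c :: "real \<Rightarrow> real"
    by (rule continuous_on_compose2[OF that continuous_on_fst[OF continuous_on_id]]) auto
  show ?thesis
    unfolding V_def posterior_mean_def split_beta'
    by (intro continuous_intros m comp[OF a_cont] comp[OF b_cont] comp[OF a'_cont] comp[OF drift_cont])
      (auto simp: a_nonzero)
qed

lemma lipschitz_ivp_V: obtains A where "0 \<le> A" "\<And>t. t \<in> {0..T} \<Longrightarrow> C11 A A (V t)" "lipschitz_ivp V T A"
proof -
  obtain A where A: "0 \<le> A" "\<And>t. t \<in> {0..T} \<Longrightarrow> C11 A A (V t)" by (rule C11_V) blast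
  moreover have "lipschitz_ivp V T A"
    using A by unfold_locales (auto intro: C11_lipschitz T_nonneg V_cont)
  ultimately show ?thesis by (rule that)
qed

text \<open>Since \<open>Z\<close> is an affine function of the interpolant and \<open>X1\<close>,
  the time derivative is affine in \<open>X1\<close> once the interpolant is known. Subtracting its
  conditional mean leaves only the deviation of \<open>X1\<close> from the posterior mean.\<close>

lemma V_residual:
  assumes "t \<in> {0..T}"
  shows "a' t *\<^sub>R Z \<omega> + b' t *\<^sub>R X1 \<omega> - V t (I t \<omega>)
    = drift t *\<^sub>R (X1 \<omega> - posterior_mean (a t) (b t) (I t \<omega>))"
  unfolding V_def I_def drift_def using a_nonzero[OF assms]
  by (simp add: scaleR_add_right scaleR_diff_right scaleR_diff_left)

lemma integrable_V: "integrable M (\<lambda>\<omega>. V t (I t \<omega>))"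
proof -
  have "integrable M (\<lambda>\<omega>. posterior_mean (a t) (b t) (I t \<omega>))"
    by (rule M.integrable_const_bound[where B = R]) (auto intro: posterior_mean_bounded)
  then show ?thesis
    unfolding V_def unfolding I_def using integrable_Z integrable_X1 by auto
qed

lemma V_conditional:
  fixes \<psi> :: "'a \<Rightarrow> real"
  assumes t: "t \<in> {0..T}" and \<psi>: "\<psi> \<in> borel_measurable borel" "\<And>x. \<bar>\<psi> x\<bar> \<le> B"
  shows "integrable M (\<lambda>\<omega>. \<psi> (I t \<omega>) *\<^sub>R (a' t *\<^sub>R Z \<omega> + b' t *\<^sub>R X1 \<omega> - V t (I t \<omega>)))"
    and "(\<integral>\<omega>. \<psi> (I t \<omega>) *\<^sub>R (a' t *\<^sub>R Z \<omega> + b' t *\<^sub>R X1 \<omega> - V t (I t \<omega>)) \<partial>M) = 0"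
proof -
  note c = conditional_mean[OF a_nonzero[OF t] \<psi>, of "b t", folded I_def]
  have eq: "\<psi> (I t \<omega>) *\<^sub>R (a' t *\<^sub>R Z \<omega> + b' t *\<^sub>R X1 \<omega> - V t (I t \<omega>)) =
    drift t *\<^sub>R (\<psi> (I t \<omega>) *\<^sub>R X1 \<omega> - \<psi> (I t \<omega>) *\<^sub>R posterior_mean (a t) (b t) (I t \<omega>))" for \<omega>
    unfolding V_residual[OF t] by (simp add: algebra_simps)
  show "integrable M (\<lambda>\<omega>. \<psi> (I t \<omega>) *\<^sub>R (a' t *\<^sub>R Z \<omega> + b' t *\<^sub>R X1 \<omega> - V t (I t \<omega>)))"
    and "(\<integral>\<omega>. \<psi> (I t \<omega>) *\<^sub>R (a' t *\<^sub>R Z \<omega> + b' t *\<^sub>R X1 \<omega> - V t (I t \<omega>)) \<partial>M) = 0"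
    unfolding eq using c by (simp_all add: Bochner_Integration.integral_diff)
qed

end

section \<open>Transport of the law along the flow\<close>

text \<open>\<open>C11\<close> says nothing direct about how the derivative depends on the base
  point. The remainder bound makes it a pointwise limit of difference quotients of the continuous
  \<open>g\<close>.\<close>

lemma C11_derivative_measurable:
  fixes g :: "'a::euclidean_space \<Rightarrow> real"
  assumes g': "\<And>x. linear (g' x)"
    and cont: "continuous_on UNIV g"
    and rem: "\<And>x y. norm (g y - g x - g' x (y - x)) \<le> C * (norm (y - x))\<^sup>2"
  shows "(\<lambda>x. g' x w) \<in> borel_measurable borel"
proof (rule borel_measurable_LIMSEQ_real)
  fix n :: nat
  have [measurable]: "g \<in> borel_measurable borel" by (rule borel_measurable_continuous_onI[OF cont])
  show "(\<lambda>x. real (Suc n) * (g (x + (1 / real (Suc n)) *\<^sub>R w) - g x)) \<in> borel_measurable borel"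
    by measurable
next
  fix x
  have bound: "norm (real (Suc n) * (g (x + (1 / real (Suc n)) *\<^sub>R w) - g x) - g' x w)
      \<le> C * (norm w)\<^sup>2 * inverse (real (Suc n))" for n
  proof -
    let ?n = "real (Suc n)"
    have "real (Suc n) * (g (x + (1 / ?n) *\<^sub>R w) - g x) - g' x w
        = ?n * (g (x + (1 / ?n) *\<^sub>R w) - g x - g' x ((1 / ?n) *\<^sub>R w))"
      by (simp add: linear_scale[OF g'] right_diff_distrib)
    also have "norm \<dots> = ?n * norm (g (x + (1 / ?n) *\<^sub>R w) - g x - g' x ((1 / ?n) *\<^sub>R w))"
      by (simp add: abs_mult)
    also have "\<dots> \<le> ?n * (C * (norm ((1 / ?n) *\<^sub>R w))\<^sup>2)"
      using rem[of "x + (1 / ?n) *\<^sub>R w" x] by (intro mult_left_mono) auto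
    also have "\<dots> = C * (norm w)\<^sup>2 * inverse ?n"
      by (simp add: power2_eq_square divide_simps)
    finally show ?thesis .
  qed
  have lim: "(\<lambda>n. C * (norm w)\<^sup>2 * inverse (real (Suc n))) \<longlonglongrightarrow> 0"
    by (rule tendsto_mult_right_zero[OF LIMSEQ_inverse_real_of_nat])
  have "(\<lambda>n. real (Suc n) * (g (x + (1 / real (Suc n)) *\<^sub>R w) - g x) - g' x w) \<longlonglongrightarrow> 0"
    by (rule Lim_null_comparison[OF always_eventually[OF allI[OF bound]] lim])
  then show "(\<lambda>n. real (Suc n) * (g (x + (1 / real (Suc n)) *\<^sub>R w) - g x)) \<longlonglongrightarrow> g' x w"
    by (rule LIM_zero_cancel)
qed

context smooth_interpolation
begin

text \<open>Expanding the linear form in the basis replaces it by finitely many scalar weights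
  \<open>g' x i\<close>, each bounded by \<open>Q\<close>, to which \<open>V_conditional\<close>
  applies.\<close>

lemma V_conditional_linear:
  fixes g' :: "'a \<Rightarrow> 'a \<Rightarrow> real"
  assumes t: "t \<in> {0..T}" and lin: "\<And>x. linear (g' x)"
    and meas: "\<And>w. (\<lambda>x. g' x w) \<in> borel_measurable borel"
    and bnd: "\<And>x w. norm (g' x w) \<le> Q * norm w"
  shows "integrable M (\<lambda>\<omega>. g' (I t \<omega>) (a' t *\<^sub>R Z \<omega> + b' t *\<^sub>R X1 \<omega> - V t (I t \<omega>)))"
    and "(\<integral>\<omega>. g' (I t \<omega>) (a' t *\<^sub>R Z \<omega> + b' t *\<^sub>R X1 \<omega> - V t (I t \<omega>)) \<partial>M) = 0"
proof -
  let ?Y = "\<lambda>\<omega>. a' t *\<^sub>R Z \<omega> + b' t *\<^sub>R X1 \<omega> - V t (I t \<omega>)"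
  have eq: "g' x y = (\<Sum>i\<in>Basis. (g' x i *\<^sub>R y) \<bullet> i)" for x y
  proof -
    have "g' x y = g' x (\<Sum>i\<in>Basis. (y \<bullet> i) *\<^sub>R i)" by (simp add: euclidean_representation)
    also have "\<dots> = (\<Sum>i\<in>Basis. (y \<bullet> i) * g' x i)" by (simp add: linear_sum[OF lin] linear_scale[OF lin])
    finally show ?thesis by (simp add: mult.commute)
  qed
  have b: "\<bar>g' x i\<bar> \<le> Q" if "i \<in> Basis" for x i using bnd[of x i] that by simp
  note c = V_conditional[OF t meas b]
  have int: "integrable M (\<lambda>\<omega>. (g' (I t \<omega>) i *\<^sub>R ?Y \<omega>) \<bullet> i)" if "i \<in> Basis" for i
    using c(1)[OF that] by (rule integrable_inner_left)
  then show "integrable M (\<lambda>\<omega>. g' (I t \<omega>) (?Y \<omega>))"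
    unfolding eq[of "I t _" "?Y _"] by (rule Bochner_Integration.integrable_sum)
  have "(\<integral>\<omega>. (g' (I t \<omega>) i *\<^sub>R ?Y \<omega>) \<bullet> i \<partial>M) = 0" if "i \<in> Basis" for i
    using integral_inner_left[OF c(1)[OF that], of i] c(2)[OF that] by simp
  then show "(\<integral>\<omega>. g' (I t \<omega>) (?Y \<omega>) \<partial>M) = 0"
    unfolding eq[of "I t _" "?Y _"] using int by (subst Bochner_Integration.integral_sum) auto
qed

text \<open>Almost surely, a multiple of \<open>W\<close> dominates all increments and velocities in
  an Euler step. The Taylor remainders are quadratic in it, which is why its second moment
  matters.\<close>

definition W :: "'b \<Rightarrow> real" where
  "W \<omega> = norm (Z \<omega>) + R"

lemma integrable_W: "integrable M W" "integrable M (\<lambda>\<omega>. (W \<omega>)\<^sup>2)"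
proof -
  show "integrable M W" using integrable_Z unfolding W_def[abs_def] by auto
  have "(W \<omega>)\<^sup>2 = (norm (Z \<omega>))\<^sup>2 + 2 * R * norm (Z \<omega>) + R\<^sup>2" for \<omega>
    by (simp add: W_def power2_eq_square algebra_simps)
  then show "integrable M (\<lambda>\<omega>. (W \<omega>)\<^sup>2)" using integrable_Z_square integrable_Z by simp
qed

lemma combination_le_W:
  assumes "norm (X1 \<omega>) \<le> R" "\<bar>p\<bar> \<le> k" "\<bar>q\<bar> \<le> k"
  shows "norm (p *\<^sub>R Z \<omega> + q *\<^sub>R X1 \<omega>) \<le> k * W \<omega>"
proof -
  have "norm (p *\<^sub>R Z \<omega> + q *\<^sub>R X1 \<omega>) \<le> k * norm (Z \<omega>) + k * R"
    using assms by (intro norm_triangle_le add_mono) (auto intro!: mult_mono)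
  then show ?thesis by (simp add: W_def distrib_left)
qed

lemma V_le_W:
  obtains K where "0 \<le> K" "\<And>t \<omega>. t \<in> {0..T} \<Longrightarrow> norm (X1 \<omega>) \<le> R \<Longrightarrow> norm (V t (I t \<omega>)) \<le> K * W \<omega>"
proof -
  obtain K1 where K1: "0 \<le> K1" "\<And>t. t \<in> {0..T} \<Longrightarrow> \<bar>a' t\<bar> \<le> K1"
    by (rule bounded_coefficient[OF a'_cont]) blast
  obtain K2 where K2: "0 \<le> K2" "\<And>t. t \<in> {0..T} \<Longrightarrow> \<bar>b' t\<bar> \<le> K2"
    by (rule bounded_coefficient[OF b'_cont]) blast
  obtain K3 where K3: "0 \<le> K3" "\<And>t. t \<in> {0..T} \<Longrightarrow> \<bar>drift t\<bar> \<le> K3"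
    by (rule bounded_coefficient[OF drift_cont]) blast
  show ?thesis
  proof (rule that[of "K1 + K2 + 2 * K3"])
    fix t \<omega> assume t: "t \<in> {0..T}" and X: "norm (X1 \<omega>) \<le> R"
    have RW: "R \<le> W \<omega>" by (simp add: W_def)
    \<comment> \<open>\<open>V_residual\<close> read backwards bounds the field through
      \<open>Z\<close>, \<open>X1\<close> and the bounded posterior mean, without an estimate of the
      interpolant.\<close>
    have "V t (I t \<omega>) = (a' t *\<^sub>R Z \<omega> + b' t *\<^sub>R X1 \<omega>)
        - drift t *\<^sub>R (X1 \<omega> - posterior_mean (a t) (b t) (I t \<omega>))"
      using V_residual[OF t, of \<omega>] by (simp add: algebra_simps)
    also have "norm \<dots> \<le> (K1 + K2) * W \<omega> + K3 * (W \<omega> + W \<omega>)"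
    proof (intro order.trans[OF norm_triangle_ineq4] add_mono)
      show "norm (a' t *\<^sub>R Z \<omega> + b' t *\<^sub>R X1 \<omega>) \<le> (K1 + K2) * W \<omega>"
        by (rule combination_le_W[OF X]) (use K1 K2 t in \<open>fastforce intro: add_increasing add_increasing2\<close>)+
      have "norm (X1 \<omega> - posterior_mean (a t) (b t) (I t \<omega>)) \<le> W \<omega> + W \<omega>"
        using X RW posterior_mean_bounded[of "a t" "b t" "I t \<omega>"]
        by (intro order.trans[OF norm_triangle_ineq4] add_mono) auto
      then show "norm (drift t *\<^sub>R (X1 \<omega> - posterior_mean (a t) (b t) (I t \<omega>))) \<le> K3 * (W \<omega> + W \<omega>)"
        unfolding norm_scaleR using K3 t by (intro mult_mono) auto
    qed
    also have "\<dots> = (K1 + K2 + 2 * K3) * W \<omega>" by (simp add: algebra_simps)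
    finally show "norm (V t (I t \<omega>)) \<le> (K1 + K2 + 2 * K3) * W \<omega>" .
  qed (use K1 K2 K3 in auto)
qed

lemma V_measurable:
  assumes "t \<in> {0..T}" shows "V t \<in> borel_measurable borel"
  unfolding V_def[abs_def] by measurable

text \<open>The increments of the interpolant and of the Euler step differ to first order by
  \<open>h *\<^sub>R Y\<close>, where \<open>Y\<close> is the residual of the velocity, and
  \<open>g'\<close> at the interpolant applied to \<open>Y\<close> has mean zero. What remains are
  two Taylor remainders of order \<open>h * h\<close> and the linearization errors of
  \<open>a\<close> and \<open>b\<close>, of order \<open>e * h\<close>. \<open>K\<close> is fixed
  before \<open>e\<close>, \<open>d\<close>, \<open>h\<close>, \<open>t\<close> and
  \<open>g\<close>, so that the errors of all steps can be added.\<close>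

lemma euler_step_error:
  obtains K where "0 \<le> K"
    "\<And>e d t h Q g. \<lbrakk>\<And>s t. s \<in> {0..T} \<Longrightarrow> t \<in> {0..T} \<Longrightarrow> \<bar>s - t\<bar> < d \<Longrightarrow>
        norm (a s - a t - (s - t) *\<^sub>R a' t) \<le> e * \<bar>s - t\<bar>;
      \<And>s t. s \<in> {0..T} \<Longrightarrow> t \<in> {0..T} \<Longrightarrow> \<bar>s - t\<bar> < d \<Longrightarrow>
        norm (b s - b t - (s - t) *\<^sub>R b' t) \<le> e * \<bar>s - t\<bar>;
      0 \<le> e; e \<le> 1; 0 \<le> h; h < d; t \<in> {0..T}; t + h \<in> {0..T}; 0 \<le> Q;
      C11 Q Q g; \<And>x. \<bar>g x\<bar> \<le> (1::real)\<rbrakk> \<Longrightarrow>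
     \<bar>(\<integral>\<omega>. g (I (t + h) \<omega>) \<partial>M) - (\<integral>\<omega>. g (I t \<omega> + h *\<^sub>R V t (I t \<omega>)) \<partial>M)\<bar> \<le> h * (e + h) * K * Q"
proof -
  obtain KV where KV: "0 \<le> KV"
    "\<And>t \<omega>. t \<in> {0..T} \<Longrightarrow> norm (X1 \<omega>) \<le> R \<Longrightarrow> norm (V t (I t \<omega>)) \<le> KV * W \<omega>"
    by (rule V_le_W) blast
  obtain K1 where K1: "0 \<le> K1" "\<And>t. t \<in> {0..T} \<Longrightarrow> \<bar>a' t\<bar> \<le> K1"
    by (rule bounded_coefficient[OF a'_cont]) blast
  obtain K2 where K2: "0 \<le> K2" "\<And>t. t \<in> {0..T} \<Longrightarrow> \<bar>b' t\<bar> \<le> K2"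
    by (rule bounded_coefficient[OF b'_cont]) blast
  \<comment> \<open>Bounds the coefficients of the increment per unit of time: \<open>K1\<close> and
    \<open>K2\<close> for the derivatives, 1 for the linearization error
    \<open>e * h \<le> h\<close>.\<close>
  define KI where "KI = K1 + K2 + 1"
  have KI: "0 \<le> KI" using K1 K2 by (simp add: KI_def)
  define E1 E2 where "E1 = (\<integral>\<omega>. W \<omega> \<partial>M)" and "E2 = (\<integral>\<omega>. (W \<omega>)\<^sup>2 \<partial>M)"
  have W: "0 \<le> W \<omega>" for \<omega> using N.R_nonneg by (simp add: W_def)
  then have E: "0 \<le> E1" "0 \<le> E2" by (simp_all add: E1_def E2_def)
  show ?thesis
  proof (rule that[of "E1 + (KI\<^sup>2 + KV\<^sup>2) * E2"])
    show "0 \<le> E1 + (KI\<^sup>2 + KV\<^sup>2) * E2" using E by simp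
    fix e d t h Q and g :: "'a \<Rightarrow> real"
    assume la: "\<And>s t. s \<in> {0..T} \<Longrightarrow> t \<in> {0..T} \<Longrightarrow> \<bar>s - t\<bar> < d \<Longrightarrow>
        norm (a s - a t - (s - t) *\<^sub>R a' t) \<le> e * \<bar>s - t\<bar>"
      and lb: "\<And>s t. s \<in> {0..T} \<Longrightarrow> t \<in> {0..T} \<Longrightarrow> \<bar>s - t\<bar> < d \<Longrightarrow>
        norm (b s - b t - (s - t) *\<^sub>R b' t) \<le> e * \<bar>s - t\<bar>"
      and e: "0 \<le> e" "e \<le> 1" and h: "0 \<le> h" "h < d" and t: "t \<in> {0..T}" "t + h \<in> {0..T}"
      and Q: "0 \<le> Q" and g: "C11 Q Q g" and g1: "\<And>x. \<bar>g x\<bar> \<le> 1"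
    from g obtain g' where g': "\<And>x. linear (g' x)" "\<And>x h. norm (g' x h) \<le> Q * norm h"
      "\<And>x y. norm (g y - g x - g' x (y - x)) \<le> Q * (norm (y - x))\<^sup>2" by (rule C11E) blast
    note cont = C11_continuous_on[OF g]
    have [measurable]: "g \<in> borel_measurable borel" by (rule borel_measurable_continuous_onI[OF cont])
    note [measurable] = V_measurable[OF t(1)]
    define u w where "u = a (t + h) - a t - h * a' t" and "w = b (t + h) - b t - h * b' t"
    have uw: "\<bar>u\<bar> \<le> e * h" "\<bar>w\<bar> \<le> e * h"
      using la[OF t(2) t(1)] lb[OF t(2) t(1)] h by (simp_all add: u_def w_def)
    define Y where "Y \<omega> = a' t *\<^sub>R Z \<omega> + b' t *\<^sub>R X1 \<omega> - V t (I t \<omega>)" for \<omega>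
    note cond = V_conditional_linear[OF t(1) g'(1) C11_derivative_measurable[OF g'(1) cont g'(3)] g'(2),
        folded Y_def]
    \<comment> \<open>The term of mean zero is subtracted before absolute values are taken; it is
      only of order \<open>h\<close> pointwise.\<close>
    define F where "F \<omega> = g (I (t + h) \<omega>) - g (I t \<omega> + h *\<^sub>R V t (I t \<omega>)) - h * g' (I t \<omega>) (Y \<omega>)" for \<omega>
    have i1: "integrable M (\<lambda>\<omega>. g (I (t + h) \<omega>))" "integrable M (\<lambda>\<omega>. g (I t \<omega> + h *\<^sub>R V t (I t \<omega>)))"
      by (rule M.integrable_const_bound[where B = 1]; simp add: g1)+
    have iF: "integrable M F" unfolding F_def[abs_def] using i1 cond(1) by auto
    have "\<bar>F \<omega>\<bar> \<le> h * (e + h) * Q * (W \<omega> + (KI\<^sup>2 + KV\<^sup>2) * (W \<omega>)\<^sup>2)" if X: "norm (X1 \<omega>) \<le> R" for \<omega>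
    proof -
      let ?I = "I t \<omega>" and ?J = "I (t + h) \<omega>" and ?V = "V t (I t \<omega>)"
      have diff: "?J - ?I = (h *\<^sub>R (a' t *\<^sub>R Z \<omega> + b' t *\<^sub>R X1 \<omega>)) + (u *\<^sub>R Z \<omega> + w *\<^sub>R X1 \<omega>)"
        by (simp add: I_def u_def w_def algebra_simps)
      have n1: "norm (u *\<^sub>R Z \<omega> + w *\<^sub>R X1 \<omega>) \<le> e * h * W \<omega>" by (rule combination_le_W[OF X uw])
      have "\<bar>h * a' t + u\<bar> \<le> h * KI" "\<bar>h * b' t + w\<bar> \<le> h * KI"
      proof -
        have "e * h \<le> 1 * h" using e h by (intro mult_right_mono)
        moreover have "\<bar>h * a' t\<bar> \<le> h * K1" "\<bar>h * b' t\<bar> \<le> h * K2" "0 \<le> h * K1" "0 \<le> h * K2"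
          using K1 K2 h t by (auto simp: abs_mult intro!: mult_left_mono)
        moreover have "h * KI = h * K1 + h * K2 + h" by (simp add: KI_def distrib_left)
        ultimately show "\<bar>h * a' t + u\<bar> \<le> h * KI" "\<bar>h * b' t + w\<bar> \<le> h * KI" using uw by linarith+
      qed
      then have "norm ((h * a' t + u) *\<^sub>R Z \<omega> + (h * b' t + w) *\<^sub>R X1 \<omega>) \<le> h * KI * W \<omega>"
        by (rule combination_le_W[OF X])
      then have n2: "norm (?J - ?I) \<le> h * KI * W \<omega>" unfolding diff by (simp add: algebra_simps)
      have n3: "norm (?I + h *\<^sub>R ?V - ?I) \<le> h * (KV * W \<omega>)"
        using mult_left_mono[OF KV(2)[OF t(1) X] h(1)] h(1) by simp
      have split: "g' ?I (?J - ?I) = h * g' ?I (Y \<omega>) + g' ?I (h *\<^sub>R ?V) + g' ?I (u *\<^sub>R Z \<omega> + w *\<^sub>R X1 \<omega>)"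
      proof -
        have "?J - ?I = h *\<^sub>R Y \<omega> + h *\<^sub>R ?V + (u *\<^sub>R Z \<omega> + w *\<^sub>R X1 \<omega>)"
          unfolding diff Y_def by (simp add: algebra_simps)
        then show ?thesis by (simp only: linear_add[OF g'(1)] linear_scale[OF g'(1)] real_scaleR_def)
      qed
      have F_eq: "F \<omega> = (g ?J - g ?I - g' ?I (?J - ?I)) - (g (?I + h *\<^sub>R ?V) - g ?I - g' ?I (?I + h *\<^sub>R ?V - ?I))
          + g' ?I (u *\<^sub>R Z \<omega> + w *\<^sub>R X1 \<omega>)"
        unfolding F_def split by simp
      have "norm (F \<omega>) \<le> Q * (norm (?J - ?I))\<^sup>2 + Q * (norm (?I + h *\<^sub>R ?V - ?I))\<^sup>2
          + Q * norm (u *\<^sub>R Z \<omega> + w *\<^sub>R X1 \<omega>)"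
        unfolding F_eq by (rule order.trans[OF norm_triangle_ineq add_mono[OF order.trans[OF norm_triangle_ineq4
              add_mono[OF g'(3) g'(3)]] g'(2)]])
      also have "\<dots> \<le> Q * (h * KI * W \<omega>)\<^sup>2 + Q * (h * (KV * W \<omega>))\<^sup>2 + Q * (e * h * W \<omega>)"
        by (intro add_mono mult_left_mono power_mono n1 n2 n3 Q norm_ge_zero)
      also have "\<dots> = h * h * Q * ((KI\<^sup>2 + KV\<^sup>2) * (W \<omega>)\<^sup>2) + h * e * Q * W \<omega>"
        by algebra
      also have "\<dots> \<le> h * (e + h) * Q * ((KI\<^sup>2 + KV\<^sup>2) * (W \<omega>)\<^sup>2) + h * (e + h) * Q * W \<omega>"
      proof (intro add_mono mult_right_mono mult_left_mono)
        show "0 \<le> (KI\<^sup>2 + KV\<^sup>2) * (W \<omega>)\<^sup>2" by (intro mult_nonneg_nonneg add_nonneg_nonneg zero_le_power2)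
      qed (use e h Q W[of \<omega>] in linarith)+
      finally show ?thesis by (simp add: distrib_left add.commute)
    qed
    then have "AE \<omega> in M. \<bar>F \<omega>\<bar> \<le> h * (e + h) * Q * (W \<omega> + (KI\<^sup>2 + KV\<^sup>2) * (W \<omega>)\<^sup>2)"
      using X1_bounded by (auto elim: eventually_mono)
    then have "(\<integral>\<omega>. \<bar>F \<omega>\<bar> \<partial>M) \<le> (\<integral>\<omega>. h * (e + h) * Q * (W \<omega> + (KI\<^sup>2 + KV\<^sup>2) * (W \<omega>)\<^sup>2) \<partial>M)"
      using iF integrable_W by (intro integral_mono_AE) auto
    also have "\<dots> = h * (e + h) * (E1 + (KI\<^sup>2 + KV\<^sup>2) * E2) * Q"
      using integrable_W by (simp add: E1_def E2_def)
    finally have "\<bar>\<integral>\<omega>. F \<omega> \<partial>M\<bar> \<le> h * (e + h) * (E1 + (KI\<^sup>2 + KV\<^sup>2) * E2) * Q"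
      using integral_abs_bound[of M F] by linarith
    moreover have "(\<integral>\<omega>. F \<omega> \<partial>M) = (\<integral>\<omega>. g (I (t + h) \<omega>) \<partial>M) - (\<integral>\<omega>. g (I t \<omega> + h *\<^sub>R V t (I t \<omega>)) \<partial>M)"
      unfolding F_def using i1 cond by simp
    ultimately show "\<bar>(\<integral>\<omega>. g (I (t + h) \<omega>) \<partial>M) - (\<integral>\<omega>. g (I t \<omega> + h *\<^sub>R V t (I t \<omega>)) \<partial>M)\<bar>
        \<le> h * (e + h) * (E1 + (KI\<^sup>2 + KV\<^sup>2) * E2) * Q" by simp
  qed
qed

end

section \<open>Accumulation of the weak error along the Euler scheme\<close>

lemma C11_add_scaleR:
  assumes "C11 A A v" "0 \<le> h"
  shows "C11 (1 + h * A) (h * A) (\<lambda>x. x + h *\<^sub>R v x)"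
  using C11_add[OF C11_id C11_scaleR[OF assms(1), of h]] assms(2) by simp

context smooth_interpolation
begin

lemma euler_measurable:
  assumes "0 \<le> h" "real j * h \<le> T"
  shows "euler V h j \<in> borel_measurable borel"
  using assms(2)
proof (induction j)
  case 0
  show ?case by simp
next
  case (Suc j)
  have t: "real j * h \<in> {0..T}" using Suc.prems assms(1) by (simp add: distrib_right)
  note [measurable] = V_measurable[OF t]
  have "euler V h j \<in> borel_measurable borel" using t by (intro Suc.IH) simp
  then show ?case by simp
qed

text \<open>The induction on \<open>j\<close> keeps \<open>g\<close> and \<open>Q\<close> arbitrary.
  Moving the last Euler step into the test function leaves one local error for \<open>g\<close>,
  plus the accumulated error over one step fewer for the composed function, whose constant is
  \<open>Q * (1 + h * B)\<close>.\<close>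

lemma euler_weak_error:
  obtains K B where "0 \<le> K" "0 \<le> B"
    "\<And>e d h j Q g. \<lbrakk>\<And>s t. s \<in> {0..T} \<Longrightarrow> t \<in> {0..T} \<Longrightarrow> \<bar>s - t\<bar> < d \<Longrightarrow>
        norm (a s - a t - (s - t) *\<^sub>R a' t) \<le> e * \<bar>s - t\<bar>;
      \<And>s t. s \<in> {0..T} \<Longrightarrow> t \<in> {0..T} \<Longrightarrow> \<bar>s - t\<bar> < d \<Longrightarrow>
        norm (b s - b t - (s - t) *\<^sub>R b' t) \<le> e * \<bar>s - t\<bar>;
      0 \<le> e; e \<le> 1; 0 \<le> h; h < d; h \<le> 1; real j * h \<le> T; 0 \<le> Q;
      C11 Q Q g; \<And>x. \<bar>g x\<bar> \<le> (1::real)\<rbrakk> \<Longrightarrow>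
     \<bar>(\<integral>\<omega>. g (I (real j * h) \<omega>) \<partial>M) - (\<integral>\<omega>. g (euler V h j (I 0 \<omega>)) \<partial>M)\<bar>
       \<le> real j * h * (e + h) * K * Q * (1 + h * B) ^ j"
proof -
  obtain A where A: "0 \<le> A" "\<And>t. t \<in> {0..T} \<Longrightarrow> C11 A A (V t)" by (rule C11_V) blast
  obtain K where K: "0 \<le> K"
    "\<And>e d t h Q g. \<lbrakk>\<And>s t. s \<in> {0..T} \<Longrightarrow> t \<in> {0..T} \<Longrightarrow> \<bar>s - t\<bar> < d \<Longrightarrow>
        norm (a s - a t - (s - t) *\<^sub>R a' t) \<le> e * \<bar>s - t\<bar>;
      \<And>s t. s \<in> {0..T} \<Longrightarrow> t \<in> {0..T} \<Longrightarrow> \<bar>s - t\<bar> < d \<Longrightarrow>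
        norm (b s - b t - (s - t) *\<^sub>R b' t) \<le> e * \<bar>s - t\<bar>;
      0 \<le> e; e \<le> 1; 0 \<le> h; h < d; t \<in> {0..T}; t + h \<in> {0..T}; 0 \<le> Q;
      C11 Q Q g; \<And>x. \<bar>g x\<bar> \<le> (1::real)\<rbrakk> \<Longrightarrow>
     \<bar>(\<integral>\<omega>. g (I (t + h) \<omega>) \<partial>M) - (\<integral>\<omega>. g (I t \<omega> + h *\<^sub>R V t (I t \<omega>)) \<partial>M)\<bar> \<le> h * (e + h) * K * Q"
    by (rule euler_step_error) blast
  \<comment> \<open>The remainder constant grows under composition by \<open>(1 + h * A)\<^sup>2 + h
    * A = 1 + 3 * h * A + h\<^sup>2 * A\<^sup>2\<close>, and \<open>h\<^sup>2 \<le> h\<close>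
    because \<open>h \<le> 1\<close>.\<close>
  define B where "B = 3 * A + A\<^sup>2"
  have B: "0 \<le> B" using A by (simp add: B_def)
  show ?thesis
  proof (rule that[OF K(1) B])
    fix e d h j Q and g :: "'a \<Rightarrow> real"
    assume la: "\<And>s t. s \<in> {0..T} \<Longrightarrow> t \<in> {0..T} \<Longrightarrow> \<bar>s - t\<bar> < d \<Longrightarrow>
        norm (a s - a t - (s - t) *\<^sub>R a' t) \<le> e * \<bar>s - t\<bar>"
      and lb: "\<And>s t. s \<in> {0..T} \<Longrightarrow> t \<in> {0..T} \<Longrightarrow> \<bar>s - t\<bar> < d \<Longrightarrow>
        norm (b s - b t - (s - t) *\<^sub>R b' t) \<le> e * \<bar>s - t\<bar>"
      and e: "0 \<le> e" "e \<le> 1" and h: "0 \<le> h" "h < d" "h \<le> 1"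
    have hB: "0 \<le> h * B" using h B by simp
    have hA: "(1 + h * A)\<^sup>2 + h * A \<le> 1 + h * B" "1 + h * A \<le> 1 + h * B"
    proof -
      have "h * (h * A\<^sup>2) \<le> 1 * (h * A\<^sup>2)" using h by (intro mult_right_mono) auto
      then show "(1 + h * A)\<^sup>2 + h * A \<le> 1 + h * B"
        by (simp add: B_def power2_eq_square algebra_simps)
      have "A \<le> B" using A by (simp add: B_def)
      then show "1 + h * A \<le> 1 + h * B" using h by (simp add: mult_left_mono)
    qed
    assume "real j * h \<le> T" "0 \<le> Q" "C11 Q Q g" "\<And>x. \<bar>g x\<bar> \<le> 1"
    then show "\<bar>(\<integral>\<omega>. g (I (real j * h) \<omega>) \<partial>M) - (\<integral>\<omega>. g (euler V h j (I 0 \<omega>)) \<partial>M)\<bar>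
       \<le> real j * h * (e + h) * K * Q * (1 + h * B) ^ j"
    proof (induction j arbitrary: g Q)
      case 0
      then show ?case by simp
    next
      case (Suc j)
      let ?t = "real j * h" and ?Q' = "Q * (1 + h * B)"
      let ?F = "\<lambda>x. x + h *\<^sub>R V ?t x"
      have s: "real (Suc j) * h = ?t + h" by (simp add: algebra_simps)
      have t: "?t \<in> {0..T}" "?t + h \<in> {0..T}" using Suc.prems(1) h unfolding s by auto
      have Q': "0 \<le> ?Q'" using Suc.prems(2) hB by simp
      have "C11 (Q * (1 + h * A)) (Q * (1 + h * A)\<^sup>2 + Q * (h * A)) (\<lambda>x. g (?F x))"
        using Suc.prems(2) by (intro C11_compose[OF Suc.prems(3)] C11_add_scaleR A t h)
      moreover have "Q * (1 + h * A) \<le> ?Q'" using hA Suc.prems(2) by (intro mult_left_mono)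
      moreover have "Q * (1 + h * A)\<^sup>2 + Q * (h * A) \<le> ?Q'"
        using mult_left_mono[OF hA(1) Suc.prems(2)] by (simp add: distrib_left)
      ultimately have C: "C11 ?Q' ?Q' (\<lambda>x. g (?F x))" by (rule C11_mono)
      have IH: "\<bar>(\<integral>\<omega>. g (?F (I ?t \<omega>)) \<partial>M) - (\<integral>\<omega>. g (?F (euler V h j (I 0 \<omega>))) \<partial>M)\<bar>
          \<le> ?t * (e + h) * K * ?Q' * (1 + h * B) ^ j"
        by (rule Suc.IH[OF _ Q' C]) (use t Suc.prems(4) in auto)
      have step: "\<bar>(\<integral>\<omega>. g (I (?t + h) \<omega>) \<partial>M) - (\<integral>\<omega>. g (?F (I ?t \<omega>)) \<partial>M)\<bar> \<le> h * (e + h) * K * Q"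
        by (rule K(2)[OF la lb e h(1,2) t Suc.prems(2-4)])
      have "1 \<le> (1 + h * B) ^ Suc j" using hB by (intro one_le_power) simp
      then have "h * (e + h) * K * Q * 1 \<le> h * (e + h) * K * Q * (1 + h * B) ^ Suc j"
        by (rule mult_left_mono) (intro mult_nonneg_nonneg add_nonneg_nonneg h e K Suc.prems)
      then have "\<bar>(\<integral>\<omega>. g (I (?t + h) \<omega>) \<partial>M) - (\<integral>\<omega>. g (?F (euler V h j (I 0 \<omega>))) \<partial>M)\<bar>
          \<le> h * (e + h) * K * Q * (1 + h * B) ^ Suc j + ?t * (e + h) * K * ?Q' * (1 + h * B) ^ j"
        using IH step by linarith
      also have "\<dots> = (?t + h) * (e + h) * K * Q * (1 + h * B) ^ Suc j"
        by (simp add: algebra_simps)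
      finally show ?case unfolding s by simp
    qed
  qed
qed

text \<open>The expectations along the Euler scheme form one sequence with two limits: the
  expectation along the flow, by pointwise convergence dominated by 1, and the expectation at the
  interpolant, by the weak error bound.\<close>

lemma transport_C11:
  assumes sol: "\<And>x. ivp_solution V T x (\<lambda>t. X t x)" and t: "t \<in> {0..T}"
    and g: "C11 Q Q g" "0 \<le> Q" and g1: "\<And>x. \<bar>g x\<bar> \<le> (1::real)"
  shows "(\<integral>\<omega>. g (X t (I 0 \<omega>)) \<partial>M) = (\<integral>\<omega>. g (I t \<omega>) \<partial>M)"
proof -
  obtain A where "lipschitz_ivp V T A" by (rule lipschitz_ivp_V)
  then interpret L: lipschitz_ivp V T A .
  obtain K B where KB: "0 \<le> K" "0 \<le> B"
    "\<And>e d h j Q g. \<lbrakk>\<And>s t. s \<in> {0..T} \<Longrightarrow> t \<in> {0..T} \<Longrightarrow> \<bar>s - t\<bar> < d \<Longrightarrow>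
        norm (a s - a t - (s - t) *\<^sub>R a' t) \<le> e * \<bar>s - t\<bar>;
      \<And>s t. s \<in> {0..T} \<Longrightarrow> t \<in> {0..T} \<Longrightarrow> \<bar>s - t\<bar> < d \<Longrightarrow>
        norm (b s - b t - (s - t) *\<^sub>R b' t) \<le> e * \<bar>s - t\<bar>;
      0 \<le> e; e \<le> 1; 0 \<le> h; h < d; h \<le> 1; real j * h \<le> T; 0 \<le> Q;
      C11 Q Q g; \<And>x. \<bar>g x\<bar> \<le> (1::real)\<rbrakk> \<Longrightarrow>
     \<bar>(\<integral>\<omega>. g (I (real j * h) \<omega>) \<partial>M) - (\<integral>\<omega>. g (euler V h j (I 0 \<omega>)) \<partial>M)\<bar>
       \<le> real j * h * (e + h) * K * Q * (1 + h * B) ^ j"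
    by (rule euler_weak_error) blast
  have [measurable]: "g \<in> borel_measurable borel"
    by (rule borel_measurable_continuous_onI[OF C11_continuous_on[OF g(1)]])
  have em: "euler V (t / real n) n \<in> borel_measurable borel" for n
    using t by (cases "n = 0") (auto intro!: euler_measurable)
  have lim: "(\<lambda>n. g (euler V (t / real n) n x)) \<longlonglongrightarrow> g (X t x)" for x
  proof -
    have "isCont g (X t x)"
      using C11_continuous_on[OF g(1), of UNIV] by (simp add: continuous_on_eq_continuous_at)
    then show ?thesis by (rule isCont_tendsto_compose[OF _ L.euler_tendsto[OF sol t]])
  qed
  note [measurable] = em
  have gm: "(\<lambda>x. g (X t x)) \<in> borel_measurable borel"
    by (rule borel_measurable_LIMSEQ_real[OF lim]) measurable
  have "(\<lambda>n. \<integral>\<omega>. g (euler V (t / real n) n (I 0 \<omega>)) \<partial>M) \<longlonglongrightarrow> (\<integral>\<omega>. g (X t (I 0 \<omega>)) \<partial>M)"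
  proof (rule integral_dominated_convergence[where w = "\<lambda>_. 1"])
    show "(\<lambda>\<omega>. g (X t (I 0 \<omega>))) \<in> borel_measurable M"
      using measurable_compose[OF measurable_I gm] .
  qed (auto intro: lim g1)
  moreover have "(\<lambda>n. \<integral>\<omega>. g (euler V (t / real n) n (I 0 \<omega>)) \<partial>M) \<longlonglongrightarrow> (\<integral>\<omega>. g (I t \<omega>) \<partial>M)"
  proof (rule tendstoI)
    fix \<epsilon> :: real assume "0 < \<epsilon>"
    define c where "c = t * K * Q * exp (t * B)"
    have c: "0 \<le> c" using t KB g(2) by (simp add: c_def)
    \<comment> \<open>Steps shorter than \<open>e\<close> make \<open>e + ?h\<close> at most
      \<open>2 * e\<close>, so the total error is at most \<open>2 * e * c\<close>. The summand 1 in
      \<open>c + 1\<close> guards against \<open>c = 0\<close>.\<close>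
    define e where "e = min 1 (\<epsilon> / (2 * (c + 1)))"
    have e: "0 < e" "e \<le> 1" using \<open>0 < \<epsilon>\<close> c by (auto simp: e_def)
    have "2 * e * c < \<epsilon>"
    proof -
      have "2 * e * c \<le> 2 * (\<epsilon> / (2 * (c + 1))) * c"
        using c by (intro mult_right_mono mult_left_mono) (auto simp: e_def)
      also have "\<dots> < \<epsilon>" using \<open>0 < \<epsilon>\<close> c by (simp add: divide_simps algebra_simps)
      finally show ?thesis .
    qed
    obtain da where da: "0 < da" "\<And>s t. s \<in> {0..T} \<Longrightarrow> t \<in> {0..T} \<Longrightarrow> \<bar>s - t\<bar> < da \<Longrightarrow>
        norm (a s - a t - (s - t) *\<^sub>R a' t) \<le> e * \<bar>s - t\<bar>"
      using uniform_linearization[OF a_deriv a'_cont e(1)] by blast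
    obtain db where db: "0 < db" "\<And>s t. s \<in> {0..T} \<Longrightarrow> t \<in> {0..T} \<Longrightarrow> \<bar>s - t\<bar> < db \<Longrightarrow>
        norm (b s - b t - (s - t) *\<^sub>R b' t) \<le> e * \<bar>s - t\<bar>"
      using uniform_linearization[OF b_deriv b'_cont e(1)] by blast
    define d where "d = min da db"
    have "(\<lambda>n. t / real n) \<longlonglongrightarrow> 0" by (rule lim_const_over_n)
    moreover have "0 < min d e" using da db e by (simp add: d_def)
    ultimately have "\<forall>\<^sub>F n in sequentially. t / real n < min d e" by (rule order_tendstoD)
    then show "\<forall>\<^sub>F n in sequentially. dist (\<integral>\<omega>. g (euler V (t / real n) n (I 0 \<omega>)) \<partial>M) (\<integral>\<omega>. g (I t \<omega>) \<partial>M) < \<epsilon>"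
      using eventually_gt_at_top[of 0]
    proof eventually_elim
      case (elim n)
      let ?h = "t / real n"
      have "?h < d" "?h < e" using elim(1) by simp_all
      moreover have "?h \<le> 1" using \<open>?h < e\<close> e(2) by linarith
      moreover have "real n * ?h = t" using elim(2) by simp
      ultimately have h: "0 \<le> ?h" "?h < d" "?h \<le> 1" "real n * ?h \<le> T" "real n * ?h = t" "?h \<le> e"
        using t by (simp_all only: atLeastAtMost_iff less_imp_le) simp
      have "\<bar>(\<integral>\<omega>. g (I (real n * ?h) \<omega>) \<partial>M) - (\<integral>\<omega>. g (euler V ?h n (I 0 \<omega>)) \<partial>M)\<bar>
        \<le> real n * ?h * (e + ?h) * K * Q * (1 + ?h * B) ^ n"
        by (rule KB(3)[OF da(2) db(2) less_imp_le[OF e(1)] e(2) h(1-4) g(2,1) g1])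
          (auto simp: d_def)
      then have "\<bar>(\<integral>\<omega>. g (I t \<omega>) \<partial>M) - (\<integral>\<omega>. g (euler V ?h n (I 0 \<omega>)) \<partial>M)\<bar>
        \<le> t * (e + ?h) * K * Q * (1 + ?h * B) ^ n" unfolding h(5) .
      also have "\<dots> \<le> t * (2 * e) * K * Q * exp (t * B)"
      proof (intro mult_mono mult_nonneg_nonneg order_refl)
        have "(1 + ?h * B) ^ n \<le> exp (?h * B) ^ n"
          using mult_nonneg_nonneg[OF h(1) KB(2)] by (intro power_mono exp_ge_add_one_self) linarith
        also have "\<dots> = exp (real n * ?h * B)" by (simp flip: exp_of_nat_mult)
        finally show "(1 + ?h * B) ^ n \<le> exp (t * B)" unfolding h(5) .
        show "0 \<le> (1 + ?h * B) ^ n" using mult_nonneg_nonneg[OF h(1) KB(2)] by simp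
      qed (use t e h KB g(2) in \<open>simp_all add: add_nonneg_nonneg\<close>)
      also have "\<dots> = 2 * e * c" by (simp add: c_def mult_ac)
      also have "\<dots> < \<epsilon>" by fact
      finally show ?case by (simp add: dist_real_def abs_minus_commute)
    qed
  qed
  ultimately show ?thesis by (rule LIMSEQ_unique)
qed

section \<open>The law of the flow and the conditional expectation behind the velocity\<close>

lemma flow_measurable:
  assumes sol: "\<And>x. ivp_solution V T x (\<lambda>t. X t x)" and t: "t \<in> {0..T}"
  shows "X t \<in> borel_measurable borel"
proof -
  obtain A where A: "0 \<le> A" "lipschitz_ivp V T A" by (rule lipschitz_ivp_V)
  then interpret L: lipschitz_ivp V T A by blast
  have "(exp (A * t))-lipschitz_on UNIV (X t)"
    by (rule lipschitz_onI) (use L.solutions_close[OF sol sol t] in \<open>simp_all add: dist_norm\<close>)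
  then show ?thesis by (intro borel_measurable_continuous_onI lipschitz_on_continuous_on)
qed

lemma flow_transports_law:
  assumes sol: "\<And>x. ivp_solution V T x (\<lambda>t. X t x)" and t: "t \<in> {0..T}"
  shows "distr (distr M borel (I 0)) borel (X t) = distr M borel (I t)"
proof (rule measure_eqI_C11)
  note [measurable] = flow_measurable[OF sol t]
  have eq: "distr (distr M borel (I 0)) borel (X t) = distr M borel (\<lambda>\<omega>. X t (I 0 \<omega>))"
    by (subst distr_distr) (auto simp: comp_def)
  show "prob_space (distr (distr M borel (I 0)) borel (X t))" unfolding eq
    by (rule M.prob_space_distr) simp
  show "prob_space (distr M borel (I t))" by (rule M.prob_space_distr) simp
  fix f :: "'a \<Rightarrow> real" and L C assume f: "C11 L C f" "\<And>x. \<bar>f x\<bar> \<le> 1"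
  define Q where "Q = max 0 (max L C)"
  have "C11 Q Q f" by (rule C11_mono[OF f(1)]) (auto simp: Q_def)
  then have "(\<integral>\<omega>. f (X t (I 0 \<omega>)) \<partial>M) = (\<integral>\<omega>. f (I t \<omega>) \<partial>M)"
    by (rule transport_C11[OF sol t _ _ f(2)]) (simp add: Q_def)
  moreover have [measurable]: "f \<in> borel_measurable borel"
    by (rule borel_measurable_continuous_onI[OF C11_continuous_on[OF f(1)]])
  ultimately show "(\<integral>x. f x \<partial>distr (distr M borel (I 0)) borel (X t)) = (\<integral>x. f x \<partial>distr M borel (I t))"
    unfolding eq by (simp add: integral_distr)
qed simp_all

text \<open>The sets of the generated sigma-algebra are preimages under \<open>I t\<close>, so the
  characterizing identity is \<open>V_conditional\<close> with \<open>\<psi>\<close> the indicator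
  of a Borel set.\<close>

lemma cond_exp_velocity:
  assumes t: "t \<in> {0..T}" and i: "i \<in> Basis"
  shows "AE \<omega> in M. V t (I t \<omega>) \<bullet> i = real_cond_exp M (vimage_algebra (space M) (I t) borel)
      (\<lambda>\<omega>. (a' t *\<^sub>R Z \<omega> + b' t *\<^sub>R X1 \<omega>) \<bullet> i) \<omega>"
proof -
  let ?F = "vimage_algebra (space M) (I t) borel"
  let ?Y = "\<lambda>\<omega>. a' t *\<^sub>R Z \<omega> + b' t *\<^sub>R X1 \<omega>"
  have setsF: "sets ?F = {I t -` S \<inter> space M | S. S \<in> sets borel}"
    by (rule sets_vimage_algebra2) simp
  have "subalgebra M ?F"
    unfolding subalgebra_def setsF by (auto intro: measurable_sets[OF measurable_I])
  then interpret F: finite_measure_subalgebra M ?F by unfold_locales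
  have iY: "integrable M ?Y" using integrable_Z integrable_X1 by auto
  have IF: "I t \<in> measurable ?F borel" by (rule measurable_vimage_algebra1) simp
  note [measurable] = V_measurable[OF t]
  have "AE \<omega> in M. real_cond_exp M ?F (\<lambda>\<omega>. ?Y \<omega> \<bullet> i) \<omega> = V t (I t \<omega>) \<bullet> i"
  proof (rule F.real_cond_exp_charact)
    show i1: "integrable M (\<lambda>\<omega>. ?Y \<omega> \<bullet> i)" and i2: "integrable M (\<lambda>\<omega>. V t (I t \<omega>) \<bullet> i)"
      by (rule integrable_inner_left[OF iY] integrable_inner_left[OF integrable_V])+
    show "(\<lambda>\<omega>. V t (I t \<omega>) \<bullet> i) \<in> borel_measurable ?F"
      by (rule measurable_compose[OF IF]) measurable
    fix S assume "S \<in> sets ?F"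
    then obtain S' where S': "S' \<in> sets borel" "S = I t -` S' \<inter> space M" unfolding setsF by blast
    have [measurable]: "(indicator S' :: 'a \<Rightarrow> real) \<in> borel_measurable borel" using S' by simp
    have SM: "S \<in> sets M" using S' by (auto intro: measurable_sets[OF measurable_I])
    have b: "\<bar>indicator S' x :: real\<bar> \<le> 1" for x :: 'a by (simp add: indicator_def)
    note c = V_conditional[OF t \<open>indicator S' \<in> borel_measurable borel\<close> b]
    have s1: "integrable M (\<lambda>\<omega>. indicator S \<omega> *\<^sub>R (?Y \<omega> \<bullet> i))"
      "integrable M (\<lambda>\<omega>. indicator S \<omega> *\<^sub>R (V t (I t \<omega>) \<bullet> i))"
      by (rule integrable_mult_indicator[OF SM i1] integrable_mult_indicator[OF SM i2])+
    have "(LINT \<omega>:S|M. ?Y \<omega> \<bullet> i) - (LINT \<omega>:S|M. V t (I t \<omega>) \<bullet> i)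
        = (\<integral>\<omega>. indicator S \<omega> *\<^sub>R (?Y \<omega> \<bullet> i) - indicator S \<omega> *\<^sub>R (V t (I t \<omega>) \<bullet> i) \<partial>M)"
      unfolding set_lebesgue_integral_def using s1 by simp
    also have "\<dots> = (\<integral>\<omega>. (indicator S' (I t \<omega>) *\<^sub>R (?Y \<omega> - V t (I t \<omega>))) \<bullet> i \<partial>M)"
      by (rule Bochner_Integration.integral_cong) (auto simp: S' indicator_def inner_diff_left)
    also have "\<dots> = 0" using integral_inner_left[OF c(1), of i] c(2) by simp
    finally show "(LINT \<omega>:S|M. ?Y \<omega> \<bullet> i) = (LINT \<omega>:S|M. V t (I t \<omega>) \<bullet> i)" by simp
  qed
  then show ?thesis by (auto elim: eventually_mono)
qed

lemma V_continuous: "continuous_on UNIV (V t)"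
  unfolding V_def by (intro continuous_intros posterior_mean_continuous)

text \<open>Two continuous versions agree almost surely at the interpolant. The set where they
  differ is open and almost surely avoided, hence empty by \<open>open_charged\<close>.\<close>

lemma cond_exp_given_velocity:
  assumes t: "t \<in> {0..T}"
  shows "cond_exp_given M (\<lambda>\<omega>. a' t *\<^sub>R Z \<omega> + b' t *\<^sub>R X1 \<omega>) (I t) = V t"
  unfolding cond_exp_given_def
proof (rule the_equality)
  show "continuous_on UNIV (V t) \<and> (\<forall>i\<in>Basis. AE \<omega> in M. V t (I t \<omega>) \<bullet> i =
      real_cond_exp M (vimage_algebra (space M) (I t) borel) (\<lambda>\<omega>. (a' t *\<^sub>R Z \<omega> + b' t *\<^sub>R X1 \<omega>) \<bullet> i) \<omega>)"
    using V_continuous cond_exp_velocity[OF t] by blast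
  fix g assume g: "continuous_on UNIV g \<and> (\<forall>i\<in>Basis. AE \<omega> in M. g (I t \<omega>) \<bullet> i =
      real_cond_exp M (vimage_algebra (space M) (I t) borel) (\<lambda>\<omega>. (a' t *\<^sub>R Z \<omega> + b' t *\<^sub>R X1 \<omega>) \<bullet> i) \<omega>)"
  have "AE \<omega> in M. \<forall>i\<in>Basis. g (I t \<omega>) \<bullet> i = V t (I t \<omega>) \<bullet> i"
  proof (rule AE_ball_countable')
    fix i :: 'a assume i: "i \<in> Basis"
    have "AE \<omega> in M. g (I t \<omega>) \<bullet> i = real_cond_exp M (vimage_algebra (space M) (I t) borel)
        (\<lambda>\<omega>. (a' t *\<^sub>R Z \<omega> + b' t *\<^sub>R X1 \<omega>) \<bullet> i) \<omega>" using g i by blast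
    then show "AE \<omega> in M. g (I t \<omega>) \<bullet> i = V t (I t \<omega>) \<bullet> i"
      using cond_exp_velocity[OF t i] by eventually_elim simp
  qed (simp add: countable_finite)
  then have "AE \<omega> in M. a t *\<^sub>R Z \<omega> + b t *\<^sub>R X1 \<omega> \<notin> {x. g x \<noteq> V t x}"
    by eventually_elim (simp add: I_def euclidean_eq_iff[where 'a = 'a])
  moreover have "open {x. g x \<noteq> V t x}"
    using g V_continuous by (intro open_Collect_neq) auto
  ultimately have "{x. g x \<noteq> V t x} = {}" by (rule open_charged[OF a_nonzero[OF t], rotated])
  then show "g = V t" by auto
qed

end

section \<open>The main theorem\<close>

text \<open>By second countability, the points outside the support are covered by countably many
  null basic open sets.\<close>

lemma AE_msupport:
  fixes \<nu> :: "'a::second_countable_topology measure"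
  assumes "sets \<nu> = sets borel"
  shows "AE x in \<nu>. x \<in> msupport \<nu>"
proof -
  obtain B :: "'a set set" where B: "countable B" "topological_basis B"
    using ex_countable_basis by blast
  have "AE x in \<nu>. \<forall>b\<in>{b \<in> B. emeasure \<nu> b = 0}. x \<notin> b"
  proof (rule AE_ball_countable')
    fix b assume "b \<in> {b \<in> B. emeasure \<nu> b = 0}"
    then have "b \<in> null_sets \<nu>" using B assms topological_basis_open[OF B(2)] by (auto simp: null_sets_def)
    then show "AE x in \<nu>. x \<notin> b" by (rule AE_not_in)
  qed (use B in simp)
  then show ?thesis
  proof eventually_elim
    case (elim x)
    show ?case
      unfolding msupport_def
    proof safe
      fix W assume W: "open W" "x \<in> W"
      obtain b where b: "b \<in> B" "x \<in> b" "b \<subseteq> W" using topological_basisE[OF B(2) W] by blast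
      then have "emeasure \<nu> b \<noteq> 0" using elim by blast
      moreover have "emeasure \<nu> b \<le> emeasure \<nu> W" using b W assms by (intro emeasure_mono) auto
      ultimately show "0 < emeasure \<nu> W" by (auto simp: zero_less_iff_neq_zero)
    qed
  qed
qed

lemma C2_on_time_deriv:
  assumes "C2_on {0..<1} f"
  shows "t \<in> {0..<1} \<Longrightarrow> (f has_vector_derivative time_deriv f t) (at t within {0..<1})"
    and "continuous_on {0..<1} (time_deriv f)"
proof -
  obtain f' where f': "\<And>t. t \<in> {0..<1} \<Longrightarrow> (f has_real_derivative f' t) (at t within {0..<1})"
    and "C1_on {0..<1} f'" using assms unfolding C2_on_def by blast
  then have cont: "continuous_on {0..<1} f'"
    unfolding C1_on_def by (blast intro: DERIV_continuous_on)
  have eq: "time_deriv f t = f' t" if t: "t \<in> {0..<1}" for t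
  proof -
    \<comment> \<open>\<open>time_deriv\<close> refers to \<open>{0..1}\<close> and
      \<open>C2_on\<close> to \<open>{0..<1}\<close>; before time 1 the two filters agree.\<close>
    have "at t within {0..1} = at t within {0..<1}"
      using t by (intro at_within_nhd[of t "{..<1}"]) auto
    then have "(f has_vector_derivative f' t) (at t within {0..1})"
      using f'[OF t] by (simp add: has_real_derivative_iff_has_vector_derivative)
    then show ?thesis
      unfolding time_deriv_def using t vector_derivative_within_cbox[of 0 1 t f "f' t"] by simp
  qed
  show "(f has_vector_derivative time_deriv f t) (at t within {0..<1})" if "t \<in> {0..<1}"
    using f'[OF that] eq[OF that] by (simp add: has_real_derivative_iff_has_vector_derivative)
  show "continuous_on {0..<1} (time_deriv f)" by (rule continuous_on_eq[OF cont]) (simp add: eq)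
qed

text \<open>At time 0 the velocity is defined as a limit of interior velocities. Continuity of
  \<open>V\<close> up to time 0 identifies this limit, given an interval to the right of 0 on which
  both fields agree.\<close>

lemma (in smooth_interpolation) velocity_eq_V:
  assumes deriv: "\<And>t. t \<in> {0..T} \<Longrightarrow> time_deriv a t = a' t" "\<And>t. t \<in> {0..T} \<Longrightarrow> time_deriv b t = b' t"
    and T: "0 < T" and t: "t \<in> {0..T}"
  shows "velocity M Z X1 a b t x = V t x"
proof -
  have int: "interior_velocity M Z X1 a b s = V s" if s: "s \<in> {0..T}" for s
    unfolding interior_velocity_def deriv[OF s] interpolant_def
    using cond_exp_given_velocity[OF s] unfolding I_def[abs_def] .
  show ?thesis
  proof (cases "t = 0")
    case True
    have "continuous_on {0..T} (\<lambda>s. (\<lambda>(t, x). V t x) (s, x))"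
      by (rule continuous_on_compose2[OF V_cont]) (auto intro!: continuous_intros)
    then have "((\<lambda>s. V s x) \<longlongrightarrow> V 0 x) (at 0 within {0..T})"
      using T by (simp add: continuous_on_def)
    then have "((\<lambda>s. V s x) \<longlongrightarrow> V 0 x) (at_right 0)"
      by (simp only: at_within_Icc_at_right[OF T])
    moreover have "\<forall>\<^sub>F s in at_right 0. V s x = interior_velocity M Z X1 a b s x"
      by (rule eventually_at_rightI[OF _ T]) (simp add: int)
    ultimately have "((\<lambda>s. interior_velocity M Z X1 a b s x) \<longlongrightarrow> V 0 x) (at_right 0)"
      by (rule Lim_transform_eventually)
    then show ?thesis
      using True by (simp add: velocity_def tendsto_Lim)
  next
    case False
    then show ?thesis by (simp add: velocity_def int[OF t])
  qed
qed

theorem theorem26: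
  fixes a b :: "real \<Rightarrow> real"
    and \<nu> \<mu> :: "'a::euclidean_space measure"
    and M :: "'b measure"
    and Z X1 :: "'b \<Rightarrow> 'a"
    and \<kappa> D tl :: real
  assumes coeffs: "interpolation_coeffs a b"
    and nu_prob: "prob_space \<nu>"
    and nu_borel: "sets \<nu> = sets borel"
    and nu_ac: "absolutely_continuous lborel \<nu>"
    and nu_moment: "integrable \<nu> (\<lambda>x. (norm x)\<^sup>2)"
    and nu_slc: "semi_log_concave \<kappa> \<nu>"
    and D_def: "D = (1 / sqrt 2) * diameter (msupport \<nu>)"
    and D_finite: "bounded (msupport \<nu>)"
    and D_pos: "0 < D"
    and M_prob: "prob_space M"
    and Z_law: "distr M borel Z = std_gaussian"
    and X1_law: "distr M borel X1 = \<nu>"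
    and indep: "prob_space.indep_var M borel Z borel X1"
    and mu: "\<mu> = distr M borel (interpolant Z X1 a b 0)"
    and tl: "0 < tl" "tl < 1"
  shows "\<exists>X :: real \<Rightarrow> 'a \<Rightarrow> 'a.
           (\<forall>x. ivp_solution (velocity M Z X1 a b) (1 - tl) x (\<lambda>t. X t x)) \<and>
           (\<forall>x y. ivp_solution (velocity M Z X1 a b) (1 - tl) x y \<longrightarrow>
              (\<forall>t\<in>{0..1 - tl}. y t = X t x)) \<and>
           (\<forall>t\<in>{0..1 - tl}.
              X t \<in> borel_measurable borel \<and>
              distr \<mu> borel (X t) = distr M borel (interpolant Z X1 a b t))"
proof -
  let ?T = "1 - tl"
  obtain R where R: "\<And>x. x \<in> msupport \<nu> \<Longrightarrow> norm x \<le> R"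
    using D_finite unfolding bounded_iff by blast
  \<comment> \<open>The finite diameter of the support enters the argument as an almost sure bound
    on the norm.\<close>
  have R': "AE x in \<nu>. norm x \<le> R" using AE_msupport[OF nu_borel] by eventually_elim (rule R)
  \<comment> \<open>The cut at \<open>1 - tl\<close> keeps the interval away from time 1, where
    \<open>a\<close> vanishes and may fail to be differentiable.\<close>
  have sub: "{0..?T} \<subseteq> {0..<1}" using tl by auto
  have C2: "C2_on {0..<1} a" "C2_on {0..<1} b" using coeffs by (auto simp: interpolation_coeffs_def)
  have a_pos: "0 < a t" if "t \<in> {0..?T}" for t
    using coeffs that tl by (cases "t = 0") (auto simp: interpolation_coeffs_def)
  interpret smooth_interpolation \<nu> R M Z X1 a b "time_deriv a" "time_deriv b" ?T
  proof (intro smooth_interpolation.intro gaussian_interpolation.intro bounded_prob.intro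
      bounded_prob_axioms.intro gaussian_interpolation_axioms.intro smooth_interpolation_axioms.intro)
    show "0 \<le> ?T" using tl by simp
    show "(a has_vector_derivative time_deriv a t) (at t within {0..?T})"
      "(b has_vector_derivative time_deriv b t) (at t within {0..?T})" if "t \<in> {0..?T}" for t
      using that sub C2_on_time_deriv(1)[OF C2(1), of t] C2_on_time_deriv(1)[OF C2(2), of t]
      by (blast intro: has_vector_derivative_within_subset)+
    show "continuous_on {0..?T} (time_deriv a)" "continuous_on {0..?T} (time_deriv b)"
      using sub C2_on_time_deriv(2)[OF C2(1)] C2_on_time_deriv(2)[OF C2(2)]
      by (blast intro: continuous_on_subset)+
  qed (fact nu_prob nu_borel R' M_prob Z_law X1_law indep a_pos)+
  have vel: "velocity M Z X1 a b t x = V t x" if "t \<in> {0..?T}" for t x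
    using that tl by (intro velocity_eq_V) auto
  \<comment> \<open>Membership of time 0 matters: the fields agree on the whole closed interval, so
    the two initial value problems have the same solutions.\<close>
  then have ivp: "ivp_solution (velocity M Z X1 a b) ?T x y \<longleftrightarrow> ivp_solution V ?T x y" for x y
    by (simp add: ivp_solution_def)
  have interp: "interpolant Z X1 a b t = I t" for t by (simp add: interpolant_def I_def[abs_def])
  obtain A where "lipschitz_ivp V ?T A" by (rule lipschitz_ivp_V)
  then interpret L: lipschitz_ivp V ?T A .
  obtain X where sol: "\<And>x. ivp_solution V ?T x (X x)" using L.solution_exists by metis
  show ?thesis
  proof (intro exI[of _ "\<lambda>t x. X x t"] conjI allI impI ballI)
    show "ivp_solution (velocity M Z X1 a b) ?T x (X x)" for x unfolding ivp by (rule sol)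
    show "y t = X x t" if "ivp_solution (velocity M Z X1 a b) ?T x y" "t \<in> {0..?T}" for x y t
      using L.solution_unique[OF _ sol] that unfolding ivp by blast
    fix t assume t: "t \<in> {0..?T}"
    show "(\<lambda>x. X x t) \<in> borel_measurable borel"
      using flow_measurable[of "\<lambda>t x. X x t", OF sol t] .
    show "distr \<mu> borel (\<lambda>x. X x t) = distr M borel (interpolant Z X1 a b t)"
      unfolding mu interp using flow_transports_law[of "\<lambda>t x. X x t", OF sol t] .
  qed
qed

end
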